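(* Let $A$ be an operator algebra (not necessarily approximately unital), let $p$ be an open projection in $A^{**}$, and let $b \in A$ with $bp = pb$ and $\Vert b(1-p) \Vert \leq 1$. Then there exists an element $g \in A$ with $\Vert g \Vert \leq 1$ and $g(1-p) = (1-p)g = b(1-p)$.
   Context: An operator algebra is a norm closed algebra $A$ of operators on a Hilbert space $H$, not assumed to have an identity. It is approximately unital if it has a contractive approximate identity. The unitization $A^1$ equals $A$ if $A$ has an identity of norm $1$, and otherwise is $A + \mathbb{C} I_H \subset B(H)$ (by a theorem of Meyer it does not depend on the completely isometric representation). Here $1$ is the identity of $A^1$. The bidual $A^{**}$ is an operator algebra with its (unique) Arens product, and is identified with the weak* closure of $A$ in $(A^1)^{**}$; if $A$ is a subalgebra of a $C^*$-algebra $B$, the product on $A^{**} \cong A^{\perp\perp} \subset B^{**}$ is that of the von Neumann algebra $B^{**}$. Products such as $b(1-p)$ are taken in $(A^1)^{**}$. A projection always means an orthogonal (self-adjoint) projection. A projection $p \in A^{**}$ is open if there is a net $(x_t)$ in $A$ with $x_t = p x_t \to p$ weak* (equivalently, a net in $A$ with $x_t = p x_t p \to p$ weak* ). *)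

theory Defs
  imports "HOL-Analysis.Analysis"
begin

section \<open>Complex normed spaces and Hilbert spaces\<close>

class complex_normed_vector = real_normed_vector +
  fixes scaleC :: "complex \<Rightarrow> 'a \<Rightarrow> 'a" (infixr "*\<^sub>C" 75)
  assumes scaleC_add_right: "c *\<^sub>C (x + y) = c *\<^sub>C x + c *\<^sub>C y"
    and scaleC_add_left: "(c + d) *\<^sub>C x = c *\<^sub>C x + d *\<^sub>C x"
    and scaleC_scaleC: "c *\<^sub>C (d *\<^sub>C x) = (c * d) *\<^sub>C x"
    and scaleC_of_real: "complex_of_real r *\<^sub>C x = r *\<^sub>R x"
    and norm_scaleC: "norm (c *\<^sub>C x) = cmod c * norm x"

class complex_hilbert_space = complex_normed_vector + complete_space +
  fixes cinner :: "'a \<Rightarrow> 'a \<Rightarrow> complex"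
  assumes cinner_commute: "cinner x y = cnj (cinner y x)"
    and cinner_add_left: "cinner (x + y) z = cinner x z + cinner y z"
    and cinner_scaleC_left: "cinner (c *\<^sub>C x) y = c * cinner x y"
    and cinner_self: "cinner x x = complex_of_real ((norm x)\<^sup>2)"

instantiation complex :: complex_hilbert_space
begin

definition scaleC_complex :: "complex \<Rightarrow> complex \<Rightarrow> complex"
  where "scaleC_complex c x = c * x"

definition cinner_complex :: "complex \<Rightarrow> complex \<Rightarrow> complex"
  where "cinner_complex x y = x * cnj y"

instance
proof
  fix x y z c d :: complex and r :: real
  show "cinner x x = complex_of_real ((norm x)\<^sup>2)"
    by (simp only: cinner_complex_def complex_norm_square)
qed (simp_all add: scaleC_complex_def cinner_complex_def algebra_simps norm_mult scaleR_conv_of_real)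

end

lemma scaleC_zero_right [simp]: "c *\<^sub>C (0::'a::complex_normed_vector) = 0"
  using scaleC_add_right[of c "0::'a" 0] by simp

lemma scaleC_one [simp]: "1 *\<^sub>C (x::'a::complex_normed_vector) = x"
  using scaleC_of_real[of 1 x] by simp

lemma scaleC_minus_right: "c *\<^sub>C (- x) = - (c *\<^sub>C (x::'a::complex_normed_vector))"
  using scaleC_add_right[of c x "- x"] by (simp add: eq_neg_iff_add_eq_0 add.commute)

lemma scaleC_diff_right: "c *\<^sub>C (x - y) = c *\<^sub>C x - c *\<^sub>C (y::'a::complex_normed_vector)"
  using scaleC_add_right[of c x "- y"] by (simp add: scaleC_minus_right)

lemma scaleC_scaleR: "c *\<^sub>C (r *\<^sub>R x) = r *\<^sub>R (c *\<^sub>C (x::'a::complex_normed_vector))"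
  by (simp add: scaleC_of_real[symmetric] scaleC_scaleC mult.commute)

lemma bounded_linear_scaleC: "bounded_linear (\<lambda>x::'a::complex_normed_vector. c *\<^sub>C x)"
  by (rule bounded_linear_intro[where K="cmod c"])
    (auto simp: scaleC_add_right scaleC_scaleR norm_scaleC mult.commute)


section \<open>Bounded complex-linear maps\<close>

typedef (overloaded) ('a, 'b) cblinfun ("(_ \<Rightarrow>\<^sub>c\<^sub>L /_)" [22, 21] 21) =
  "{f :: 'a::complex_normed_vector \<Rightarrow> 'b::complex_normed_vector.
      bounded_linear f \<and> (\<forall>c x. f (c *\<^sub>C x) = c *\<^sub>C f x)}"
  morphisms cblinfun_apply CBlinfun
  by (rule exI[where x="\<lambda>_. 0"]) (simp add: bounded_linear_zero)

declare [[coercion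
  "cblinfun_apply :: ('a::complex_normed_vector \<Rightarrow>\<^sub>c\<^sub>L 'b::complex_normed_vector) \<Rightarrow> 'a \<Rightarrow> 'b"]]

setup_lifting type_definition_cblinfun

instantiation cblinfun :: (complex_normed_vector, complex_normed_vector) complex_normed_vector
begin

lift_definition norm_cblinfun :: "('a \<Rightarrow>\<^sub>c\<^sub>L 'b) \<Rightarrow> real" is onorm .

lift_definition minus_cblinfun :: "('a \<Rightarrow>\<^sub>c\<^sub>L 'b) \<Rightarrow> ('a \<Rightarrow>\<^sub>c\<^sub>L 'b) \<Rightarrow> ('a \<Rightarrow>\<^sub>c\<^sub>L 'b)"
  is "\<lambda>f g x. f x - g x"
  by (auto simp: bounded_linear_sub scaleC_diff_right)

definition dist_cblinfun :: "('a \<Rightarrow>\<^sub>c\<^sub>L 'b) \<Rightarrow> ('a \<Rightarrow>\<^sub>c\<^sub>L 'b) \<Rightarrow> real"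
  where "dist_cblinfun S T = norm (S - T)"

definition uniformity_cblinfun :: "(('a \<Rightarrow>\<^sub>c\<^sub>L 'b) \<times> ('a \<Rightarrow>\<^sub>c\<^sub>L 'b)) filter"
  where "uniformity_cblinfun = (INF e\<in>{0 <..}. principal {(x, y). dist x y < e})"

definition open_cblinfun :: "('a \<Rightarrow>\<^sub>c\<^sub>L 'b) set \<Rightarrow> bool"
  where "open_cblinfun S = (\<forall>x\<in>S. \<forall>\<^sub>F (x', y) in uniformity. x' = x \<longrightarrow> y \<in> S)"

lift_definition uminus_cblinfun :: "('a \<Rightarrow>\<^sub>c\<^sub>L 'b) \<Rightarrow> ('a \<Rightarrow>\<^sub>c\<^sub>L 'b)" is "\<lambda>f x. - f x"
  by (auto simp: bounded_linear_minus scaleC_minus_right)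

lift_definition zero_cblinfun :: "'a \<Rightarrow>\<^sub>c\<^sub>L 'b" is "\<lambda>x. 0"
  by (simp add: bounded_linear_zero)

lift_definition plus_cblinfun :: "('a \<Rightarrow>\<^sub>c\<^sub>L 'b) \<Rightarrow> ('a \<Rightarrow>\<^sub>c\<^sub>L 'b) \<Rightarrow> ('a \<Rightarrow>\<^sub>c\<^sub>L 'b)"
  is "\<lambda>f g x. f x + g x"
  by (auto simp: bounded_linear_add scaleC_add_right)

lift_definition scaleR_cblinfun :: "real \<Rightarrow> ('a \<Rightarrow>\<^sub>c\<^sub>L 'b) \<Rightarrow> ('a \<Rightarrow>\<^sub>c\<^sub>L 'b)"
  is "\<lambda>r f x. r *\<^sub>R f x"
  by (auto simp: scaleC_scaleR intro: bounded_linear_compose[OF bounded_linear_scaleR_right])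

lift_definition scaleC_cblinfun :: "complex \<Rightarrow> ('a \<Rightarrow>\<^sub>c\<^sub>L 'b) \<Rightarrow> ('a \<Rightarrow>\<^sub>c\<^sub>L 'b)"
  is "\<lambda>c f x. c *\<^sub>C f x"
  by (auto simp: scaleC_scaleC mult.commute intro: bounded_linear_compose[OF bounded_linear_scaleC])

definition sgn_cblinfun :: "('a \<Rightarrow>\<^sub>c\<^sub>L 'b) \<Rightarrow> ('a \<Rightarrow>\<^sub>c\<^sub>L 'b)"
  where "sgn_cblinfun x = scaleR (inverse (norm x)) x"

instance
proof
  fix S T U :: "'a \<Rightarrow>\<^sub>c\<^sub>L 'b" and r s :: real and c d :: complex and X :: "('a \<Rightarrow>\<^sub>c\<^sub>L 'b) set"
  show "dist S T = norm (S - T)" by (rule dist_cblinfun_def)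
  show "sgn S = scaleR (inverse (norm S)) S" by (rule sgn_cblinfun_def)
  show "(uniformity :: (('a \<Rightarrow>\<^sub>c\<^sub>L 'b) \<times> ('a \<Rightarrow>\<^sub>c\<^sub>L 'b)) filter) =
      (INF e\<in>{0 <..}. principal {(x, y). dist x y < e})"
    by (rule uniformity_cblinfun_def)
  show "open X = (\<forall>x\<in>X. \<forall>\<^sub>F (x', y) in uniformity. x' = x \<longrightarrow> y \<in> X)"
    by (rule open_cblinfun_def)
  show "S + T + U = S + (T + U)" "S + T = T + S" "0 + S = S" "- S + S = 0" "S - T = S + - T"
    by (transfer, simp add: algebra_simps)+
  show "r *\<^sub>R (S + T) = r *\<^sub>R S + r *\<^sub>R T" "(r + s) *\<^sub>R S = r *\<^sub>R S + s *\<^sub>R S"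
    "r *\<^sub>R s *\<^sub>R S = (r * s) *\<^sub>R S" "1 *\<^sub>R S = S"
    by (transfer, simp add: algebra_simps)+
  show "(norm S = 0) = (S = 0)" by transfer (auto simp: onorm_eq_0 fun_eq_iff)
  show "norm (S + T) \<le> norm S + norm T" by transfer (auto simp: onorm_triangle)
  show "norm (r *\<^sub>R S) = \<bar>r\<bar> * norm S" by transfer (auto simp: onorm_scaleR)
  show "c *\<^sub>C (S + T) = c *\<^sub>C S + c *\<^sub>C T" "(c + d) *\<^sub>C S = c *\<^sub>C S + d *\<^sub>C S"
    "c *\<^sub>C (d *\<^sub>C S) = (c * d) *\<^sub>C S" "complex_of_real r *\<^sub>C S = r *\<^sub>R S"
    by (transfer, simp add: scaleC_add_right scaleC_add_left scaleC_scaleC scaleC_of_real)+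
  show "norm (c *\<^sub>C S) = cmod c * norm S"
  proof transfer
    fix c :: complex and f :: "'a \<Rightarrow> 'b"
    assume "bounded_linear f \<and> (\<forall>c x. f (c *\<^sub>C x) = c *\<^sub>C f x)"
    then have f: "bounded_linear f" by simp
    have "onorm (\<lambda>x. c *\<^sub>C f x) = onorm (\<lambda>x. cmod c *\<^sub>R f x)"
      by (simp add: onorm_def norm_scaleC)
    also have "\<dots> = cmod c * onorm f" by (simp add: onorm_scaleR[OF f])
    finally show "onorm (\<lambda>x. c *\<^sub>C f x) = cmod c * onorm f" .
  qed
qed

end

lemma cblinfun_eqI: "(\<And>x. cblinfun_apply S x = cblinfun_apply T x) \<Longrightarrow> S = T"
  by transfer auto

lemma bounded_linear_cblinfun: "bounded_linear (cblinfun_apply T)"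
  by transfer auto

lemma cblinfun_add: "cblinfun_apply T (x + y) = cblinfun_apply T x + cblinfun_apply T y"
  by (rule bounded_linear.axioms(1)[OF bounded_linear_cblinfun, THEN linear_add])

lemma cblinfun_diff: "cblinfun_apply T (x - y) = cblinfun_apply T x - cblinfun_apply T y"
  by (rule bounded_linear.axioms(1)[OF bounded_linear_cblinfun, THEN linear_diff])

lemma cblinfun_scaleC: "cblinfun_apply T (c *\<^sub>C x) = c *\<^sub>C cblinfun_apply T x"
  by transfer auto

lemma norm_cblinfun: "norm (cblinfun_apply T x) \<le> norm T * norm x"
  by transfer (auto intro: onorm)

lemma norm_cblinfun_bound:
  "0 \<le> b \<Longrightarrow> (\<And>x. norm (cblinfun_apply T x) \<le> b * norm x) \<Longrightarrow> norm T \<le> b"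
  by transfer (auto intro: onorm_bound)

lemma cblinfun_raw:
  assumes "\<And>x y. f (x + y) = f x + f y" and sc: "\<And>c x. f (c *\<^sub>C x) = c *\<^sub>C f x"
    and "\<And>x. norm (f x) \<le> K * norm x"
  shows "bounded_linear f \<and> (\<forall>c x. f (c *\<^sub>C x) = c *\<^sub>C f x)"
proof -
  have "f (r *\<^sub>R x) = r *\<^sub>R f x" for r x
    using sc[of "complex_of_real r" x] by (simp add: scaleC_of_real)
  then have "bounded_linear f"
    using assms by (intro bounded_linear_intro[where K=K]) (auto simp: mult.commute)
  then show ?thesis using sc by blast
qed

lift_definition cid :: "'a::complex_normed_vector \<Rightarrow>\<^sub>c\<^sub>L 'a" is "\<lambda>x. x"
  by simp

lift_definition ccomp :: "('b::complex_normed_vector \<Rightarrow>\<^sub>c\<^sub>L 'c::complex_normed_vector) \<Rightarrow>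
    ('a::complex_normed_vector \<Rightarrow>\<^sub>c\<^sub>L 'b) \<Rightarrow> ('a \<Rightarrow>\<^sub>c\<^sub>L 'c)" (infixl "\<cdot>" 70) is "\<lambda>S T x. S (T x)"
  by (auto intro: bounded_linear_compose)

lemma norm_ccomp: "norm (S \<cdot> T) \<le> norm S * norm T"
proof (rule norm_cblinfun_bound)
  fix x
  have "norm ((S \<cdot> T) x) \<le> norm S * norm (T x)"
    by (simp add: ccomp.rep_eq norm_cblinfun)
  also have "\<dots> \<le> norm S * (norm T * norm x)"
    by (intro mult_left_mono norm_cblinfun norm_ge_zero)
  finally show "norm ((S \<cdot> T) x) \<le> norm S * norm T * norm x" by (simp add: mult.assoc)
qed simp

lemma ccomp_add_right: "S \<cdot> (T + U) = S \<cdot> T + S \<cdot> U"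
  by (rule cblinfun_eqI) (simp add: ccomp.rep_eq plus_cblinfun.rep_eq cblinfun_add)

lemma ccomp_add_left: "(S + T) \<cdot> U = S \<cdot> U + T \<cdot> U"
  by (rule cblinfun_eqI) (simp add: ccomp.rep_eq plus_cblinfun.rep_eq)

lemma ccomp_scaleC_right: "S \<cdot> (c *\<^sub>C T) = c *\<^sub>C (S \<cdot> T)"
  by (rule cblinfun_eqI) (simp add: ccomp.rep_eq scaleC_cblinfun.rep_eq cblinfun_scaleC)

lemma ccomp_scaleC_left: "(c *\<^sub>C S) \<cdot> T = c *\<^sub>C (S \<cdot> T)"
  by (rule cblinfun_eqI) (simp add: ccomp.rep_eq scaleC_cblinfun.rep_eq)

lemma ccomp_assoc: "S \<cdot> T \<cdot> U = S \<cdot> (T \<cdot> U)"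
  by (rule cblinfun_eqI) (simp add: ccomp.rep_eq)

lemma ccomp_cid [simp]: "cid \<cdot> T = T" "T \<cdot> cid = T"
  by (rule cblinfun_eqI, simp add: ccomp.rep_eq cid.rep_eq)+


section \<open>Adjoints\<close>

lemma cinner_add_right:
  "cinner (x::'h::complex_hilbert_space) (y + z) = cinner x y + cinner x z"
  by (metis cinner_commute cinner_add_left complex_cnj_add)

lemma cinner_scaleC_right: "cinner (x::'h::complex_hilbert_space) (c *\<^sub>C y) = cnj c * cinner x y"
  by (metis cinner_commute cinner_scaleC_left complex_cnj_mult)

lemma cinner_minus_left: "cinner (- x::'h::complex_hilbert_space) y = - cinner x y"
  using cinner_add_left[of x "- x" y] cinner_add_left[of 0 0 y] by (simp add: eq_neg_iff_add_eq_0 add.commute)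

lemma cinner_minus_right: "cinner (x::'h::complex_hilbert_space) (- y) = - cinner x y"
  by (metis cinner_commute cinner_minus_left complex_cnj_minus)

lemma cinner_diff_left: "cinner (x - y::'h::complex_hilbert_space) z = cinner x z - cinner y z"
  using cinner_add_left[of x "- y" z] by (simp add: cinner_minus_left)

lemma cinner_diff_right: "cinner (x::'h::complex_hilbert_space) (y - z) = cinner x y - cinner x z"
  using cinner_add_right[of x y "- z"] by (simp add: cinner_minus_right)

lemma norm_add_square:
  "(norm (x + y::'h::complex_hilbert_space))\<^sup>2 = (norm x)\<^sup>2 + (norm y)\<^sup>2 + 2 * Re (cinner x y)"
proof -
  have "complex_of_real ((norm (x + y))\<^sup>2) =
      complex_of_real ((norm x)\<^sup>2) + complex_of_real ((norm y)\<^sup>2) + (cinner x y + cnj (cinner x y))"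
    unfolding cinner_self[symmetric] cinner_add_left cinner_add_right
    using cinner_commute[of y x] by simp
  also have "\<dots> = complex_of_real ((norm x)\<^sup>2 + (norm y)\<^sup>2 + 2 * Re (cinner x y))"
    by (simp add: complex_add_cnj)
  finally show ?thesis by (simp only: of_real_eq_iff)
qed

lemma parallelogram_law:
  "(norm (x - y::'h::complex_hilbert_space))\<^sup>2 + (norm (x + y))\<^sup>2 = 2 * (norm x)\<^sup>2 + 2 * (norm y)\<^sup>2"
  using norm_add_square[of x y] norm_add_square[of x "- y"] by (simp add: cinner_minus_right)

lemma cinner_eq_0_if_norm_min:
  fixes u v :: "'h::complex_hilbert_space"
  assumes "\<And>c. norm u \<le> norm (u + c *\<^sub>C v)"
  shows "cinner v u = 0"
proof (cases "v = 0")
  case True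
  then show ?thesis using cinner_add_left[of 0 0 u] by simp
next
  case False
  define z where "z = cinner v u"
  define r where "r = 1 / (norm v)\<^sup>2"
  define c where "c = - complex_of_real r * cnj z"
  have nv: "(norm v)\<^sup>2 > 0" using False by simp
  have zz: "cnj z * z = complex_of_real ((cmod z)\<^sup>2)"
    by (metis complex_norm_square mult.commute)
  have "cinner u (c *\<^sub>C v) = cnj (c * z)"
    by (metis cinner_commute cinner_scaleC_left z_def)
  then have "Re (cinner u (c *\<^sub>C v)) = Re (c * z)" by simp
  also have "c * z = complex_of_real (- r * (cmod z)\<^sup>2)"
    unfolding c_def using zz by (simp add: mult.assoc)
  finally have re: "Re (cinner u (c *\<^sub>C v)) = - r * (cmod z)\<^sup>2" by simp
  have "(norm (c *\<^sub>C v))\<^sup>2 = r\<^sup>2 * (cmod z)\<^sup>2 * (norm v)\<^sup>2"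
    by (simp add: norm_scaleC c_def norm_mult power_mult_distrib)
  also have "\<dots> = r * (cmod z)\<^sup>2"
    using nv by (simp add: r_def power2_eq_square field_simps)
  finally have nc: "(norm (c *\<^sub>C v))\<^sup>2 = r * (cmod z)\<^sup>2" .
  have "(norm u)\<^sup>2 \<le> (norm (u + c *\<^sub>C v))\<^sup>2" by (rule power_mono[OF assms norm_ge_zero])
  then have "r * (cmod z)\<^sup>2 \<le> 0" using norm_add_square[of u "c *\<^sub>C v"] re nc by simp
  then have "(cmod z)\<^sup>2 \<le> 0" using nv by (simp add: r_def divide_le_0_iff)
  then show ?thesis by (simp add: z_def)
qed

lemma cmod_cinner_le: "cmod (cinner x y) \<le> norm x * norm (y::'h::complex_hilbert_space)"
proof (cases "y = 0")
  case True
  then show ?thesis using cinner_add_right[of x 0 0] by simp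
next
  case False
  define z where "z = cinner x y"
  define w where "w = ((norm y)\<^sup>2) *\<^sub>R x - z *\<^sub>C y"
  have ny: "norm y > 0" using False by simp
  have zz: "cnj z * z = complex_of_real ((cmod z)\<^sup>2)"
    by (metis complex_norm_square mult.commute)
  have w: "w = complex_of_real ((norm y)\<^sup>2) *\<^sub>C x - z *\<^sub>C y"
    by (simp only: w_def scaleC_of_real)
  have yx: "cinner y x = cnj z" using cinner_commute[of y x] by (simp add: z_def)
  have wy: "cinner w y = 0"
    by (simp only: w cinner_diff_left cinner_scaleC_left cinner_self) (simp add: z_def mult.commute)
  have "cinner w w = cinner w (complex_of_real ((norm y)\<^sup>2) *\<^sub>C x) - cinner w (z *\<^sub>C y)"
    by (subst (2) w) (rule cinner_diff_right)
  also have "\<dots> = complex_of_real ((norm y)\<^sup>2) * cinner w x"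
    by (simp only: cinner_scaleC_right wy complex_cnj_complex_of_real) simp
  also have "cinner w x = complex_of_real ((norm y)\<^sup>2 * (norm x)\<^sup>2 - (cmod z)\<^sup>2)"
    by (simp only: w cinner_diff_left cinner_scaleC_left cinner_self yx)
      (metis zz mult.commute of_real_diff of_real_mult)
  finally have "complex_of_real ((norm w)\<^sup>2) =
      complex_of_real ((norm y)\<^sup>2 * ((norm y)\<^sup>2 * (norm x)\<^sup>2 - (cmod z)\<^sup>2))"
    by (simp only: cinner_self of_real_mult)
  then have "(norm w)\<^sup>2 = (norm y)\<^sup>2 * ((norm y)\<^sup>2 * (norm x)\<^sup>2 - (cmod z)\<^sup>2)"
    by (simp only: of_real_eq_iff)
  then have "0 \<le> (norm y)\<^sup>2 * ((norm y)\<^sup>2 * (norm x)\<^sup>2 - (cmod z)\<^sup>2)"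
    by (metis zero_le_power2)
  then have "(cmod z)\<^sup>2 \<le> (norm x * norm y)\<^sup>2"
    using ny by (simp add: zero_le_mult_iff power_mult_distrib mult.commute)
  then show ?thesis unfolding z_def by (rule power2_le_imp_le) simp
qed

lemma riesz_representation:
  fixes f :: "'h::complex_hilbert_space \<Rightarrow>\<^sub>c\<^sub>L complex"
  shows "\<exists>y. \<forall>x. f x = cinner x y"
proof (cases "f = 0")
  case True
  have "cinner x 0 = 0" for x :: 'h using cinner_add_right[of x 0 0] by simp
  then show ?thesis using True by (auto simp: zero_cblinfun.rep_eq intro!: exI[where x=0])
next
  case False
  then obtain a where a: "f a \<noteq> 0"
    using cblinfun_eqI[of f 0] by (auto simp: zero_cblinfun.rep_eq)
  define K where "K = {x. f x = 1}"
  have "f ((1 / f a) *\<^sub>C a) = 1" using a by (simp add: cblinfun_scaleC scaleC_complex_def)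
  then have ne: "K \<noteq> {}" unfolding K_def by blast
  define d where "d = (INF x\<in>K. norm x)"
  have bdd: "bdd_below (norm ` K)" by (rule bdd_belowI[where m=0]) auto
  have dle: "d \<le> norm x" if "x \<in> K" for x
    unfolding d_def by (rule cINF_lower[OF bdd that])
  have d0: "0 \<le> d" unfolding d_def by (rule cINF_greatest[OF ne]) simp
  have "\<exists>x\<in>K. norm x < d + 1 / real (Suc n)" for n
  proof -
    have "d < d + 1 / real (Suc n)" by simp
    then show ?thesis unfolding d_def cINF_less_iff[OF ne bdd] .
  qed
  then obtain s where sK: "\<And>n. s n \<in> K" and s: "\<And>n. norm (s n) < d + 1 / real (Suc n)"
    by metis
  have lim: "(\<lambda>n. norm (s n)) \<longlonglongrightarrow> d"
  proof (rule tendsto_sandwich[where f="\<lambda>_. d" and h="\<lambda>n. d + 1 / real (Suc n)"])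
    show "(\<lambda>n. d + 1 / real (Suc n)) \<longlonglongrightarrow> d"
      using tendsto_add[OF tendsto_const[of d] LIMSEQ_inverse_real_of_nat]
      by (simp add: inverse_eq_divide)
    show "\<forall>\<^sub>F n in sequentially. norm (s n) \<le> d + 1 / real (Suc n)"
      using s by (intro always_eventually allI less_imp_le)
  qed (use sK dle in auto)
  have mid: "2 * d \<le> norm (x + y)" if "x \<in> K" "y \<in> K" for x y
  proof -
    have "(1/2) *\<^sub>C (x + y) \<in> K"
      using that by (simp add: K_def cblinfun_scaleC cblinfun_add scaleC_complex_def)
    from dle[OF this] show ?thesis by (simp add: norm_scaleC)
  qed
  have "Cauchy s"
  proof (rule metric_CauchyI)
    fix e :: real assume e: "e > 0"
    have "(\<lambda>n. (norm (s n))\<^sup>2) \<longlonglongrightarrow> d\<^sup>2" by (intro tendsto_power lim)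
    moreover have "d\<^sup>2 < d\<^sup>2 + e\<^sup>2 / 4" using e by simp
    ultimately have "\<forall>\<^sub>F n in sequentially. (norm (s n))\<^sup>2 < d\<^sup>2 + e\<^sup>2 / 4"
      by (rule order_tendstoD)
    then obtain N where N: "\<And>n. n \<ge> N \<Longrightarrow> (norm (s n))\<^sup>2 < d\<^sup>2 + e\<^sup>2 / 4"
      by (auto simp: eventually_sequentially)
    have "dist (s m) (s n) < e" if "m \<ge> N" "n \<ge> N" for m n
    proof -
      have "(2 * d)\<^sup>2 \<le> (norm (s m + s n))\<^sup>2"
        using mid[OF sK sK] d0 by (intro power_mono) auto
      then have "(norm (s m - s n))\<^sup>2 < e\<^sup>2"
        using parallelogram_law[of "s m" "s n"] N[OF that(1)] N[OF that(2)]
        by (simp add: power_mult_distrib)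
      then show ?thesis using e by (simp add: dist_norm power2_less_imp_less)
    qed
    then show "\<exists>M. \<forall>m\<ge>M. \<forall>n\<ge>M. dist (s m) (s n) < e" by blast
  qed
  then obtain u where u: "s \<longlonglongrightarrow> u" using Cauchy_convergent convergent_def by blast
  have "(\<lambda>n. f (s n)) \<longlonglongrightarrow> f u"
    by (rule bounded_linear.tendsto[OF bounded_linear_cblinfun u])
  moreover have "(\<lambda>n. f (s n)) = (\<lambda>n. 1)" using sK by (simp add: K_def)
  ultimately have fu: "f u = 1" by (metis LIMSEQ_unique tendsto_const)
  have nu: "norm u = d" using tendsto_norm[OF u] lim by (rule LIMSEQ_unique)
  have orth: "cinner v u = 0" if "f v = 0" for v
  proof (rule cinner_eq_0_if_norm_min)
    fix c
    have "u + c *\<^sub>C v \<in> K"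
      using that fu by (simp add: K_def cblinfun_add cblinfun_scaleC scaleC_complex_def)
    from dle[OF this] show "norm u \<le> norm (u + c *\<^sub>C v)" by (simp add: nu)
  qed
  have "u \<noteq> 0" using fu bounded_linear.axioms(1)[OF bounded_linear_cblinfun, THEN linear_0, of f] by auto
  show ?thesis
  proof (intro exI allI)
    fix x
    have "f (x - f x *\<^sub>C u) = 0"
      using fu by (simp add: cblinfun_diff cblinfun_scaleC scaleC_complex_def)
    from orth[OF this] have "cinner x u = f x * complex_of_real ((norm u)\<^sup>2)"
      by (simp only: cinner_diff_left cinner_scaleC_left cinner_self) simp
    note xu = this
    define r where "r = 1 / (norm u)\<^sup>2"
    have "r * (norm u)\<^sup>2 = 1" using \<open>u \<noteq> 0\<close> by (simp add: r_def)
    then have r: "complex_of_real r * complex_of_real ((norm u)\<^sup>2) = 1"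
      by (simp only: of_real_mult[symmetric] of_real_1)
    have "cinner x (complex_of_real r *\<^sub>C u) = complex_of_real r * cinner x u"
      by (simp only: cinner_scaleC_right complex_cnj_complex_of_real)
    also have "\<dots> = f x * (complex_of_real r * complex_of_real ((norm u)\<^sup>2))"
      by (simp only: xu mult.left_commute)
    also have "\<dots> = f x" by (simp only: r mult_1_right)
    finally show "f x = cinner x (complex_of_real (1 / (norm u)\<^sup>2) *\<^sub>C u)"
      by (simp only: r_def)
  qed
qed

lemma cinner_right_unique:
  fixes y z :: "'h::complex_hilbert_space"
  assumes "\<And>x. cinner x y = cinner x z"
  shows "y = z"
proof -
  have "cinner (y - z) (y - z) = 0" using assms[of "y - z"] by (simp only: cinner_diff_right) simp
  then show ?thesis by (simp add: cinner_self)
qed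

lemma adjoint_exists:
  fixes T :: "'h::complex_hilbert_space \<Rightarrow>\<^sub>c\<^sub>L 'h"
  shows "\<exists>S :: 'h \<Rightarrow>\<^sub>c\<^sub>L 'h. \<forall>x y. cinner (T x) y = cinner x (S y)"
proof -
  have "\<exists>z. \<forall>x. cinner (T x) y = cinner x z" for y
  proof -
    have "bounded_linear (\<lambda>x. cinner (T x) y) \<and>
        (\<forall>c x. cinner (T (c *\<^sub>C x)) y = c *\<^sub>C cinner (T x) y)"
    proof (rule cblinfun_raw[where K="norm T * norm y"])
      fix x
      have "cmod (cinner (T x) y) \<le> norm (T x) * norm y" by (rule cmod_cinner_le)
      also have "\<dots> \<le> norm T * norm x * norm y" by (intro mult_right_mono norm_cblinfun norm_ge_zero)
      finally show "cmod (cinner (T x) y) \<le> norm T * norm y * norm x" by (simp add: ac_simps)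
    qed (simp_all add: cblinfun_add cblinfun_scaleC cinner_add_left cinner_scaleC_left scaleC_complex_def)
    then have "cblinfun_apply (CBlinfun (\<lambda>x. cinner (T x) y)) = (\<lambda>x. cinner (T x) y)"
      by (simp add: CBlinfun_inverse)
    then show ?thesis using riesz_representation[of "CBlinfun (\<lambda>x. cinner (T x) y)"] by simp
  qed
  then obtain S where S: "\<And>x y. cinner (T x) y = cinner x (S y)" by metis
  have "bounded_linear S \<and> (\<forall>c x. S (c *\<^sub>C x) = c *\<^sub>C S x)"
  proof (rule cblinfun_raw[where K="norm T"])
    show "S (y + z) = S y + S z" for y z
      by (rule cinner_right_unique) (simp add: S[symmetric] cinner_add_right)
    show "S (c *\<^sub>C y) = c *\<^sub>C S y" for c y
      by (rule cinner_right_unique) (simp add: S[symmetric] cinner_scaleC_right)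
    show "norm (S y) \<le> norm T * norm y" for y
    proof (cases "norm (S y) = 0")
      case False
      have "cmod (cinner (T (S y)) y) = cmod (complex_of_real ((norm (S y))\<^sup>2))"
        by (simp only: S cinner_self)
      then have "(norm (S y))\<^sup>2 = cmod (cinner (T (S y)) y)"
        by (simp only: norm_of_real) simp
      also have "\<dots> \<le> norm (T (S y)) * norm y" by (rule cmod_cinner_le)
      also have "\<dots> \<le> norm T * norm (S y) * norm y"
        by (intro mult_right_mono norm_cblinfun norm_ge_zero)
      finally show ?thesis using False by (simp add: power2_eq_square)
    qed simp
  qed
  then have "cblinfun_apply (CBlinfun S) = S" by (simp add: CBlinfun_inverse)
  then show ?thesis using S by (intro exI[where x="CBlinfun S"]) simp
qed

definition adj :: "('h::complex_hilbert_space \<Rightarrow>\<^sub>c\<^sub>L 'h) \<Rightarrow> ('h \<Rightarrow>\<^sub>c\<^sub>L 'h)"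
  where "adj T = (THE S :: 'h \<Rightarrow>\<^sub>c\<^sub>L 'h. \<forall>x y. cinner (T x) y = cinner x (S y))"

lemma cinner_adj: "cinner (cblinfun_apply T x) y = cinner x (cblinfun_apply (adj T) y)"
proof -
  have "\<exists>!S :: 'a \<Rightarrow>\<^sub>c\<^sub>L 'a. \<forall>x y. cinner (T x) y = cinner x (S y)"
  proof (rule ex_ex1I[OF adjoint_exists])
    fix S S' :: "'a \<Rightarrow>\<^sub>c\<^sub>L 'a"
    assume S: "\<forall>x y. cinner (T x) y = cinner x (S y)"
      and S': "\<forall>x y. cinner (T x) y = cinner x (S' y)"
    have "cinner x (S y) = cinner x (S' y)" for x y
      using S[rule_format, of x y] S'[rule_format, of x y] by (rule trans[OF sym])
    then show "S = S'" by - (rule cblinfun_eqI, rule cinner_right_unique)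
  qed
  then have "\<forall>x y. cinner (T x) y = cinner x (adj T y)" unfolding adj_def by (rule theI')
  from this[rule_format] show ?thesis .
qed

lemma adj_unique:
  assumes S: "\<And>x y. cinner (cblinfun_apply T x) y = cinner x (cblinfun_apply S y)"
  shows "adj T = S"
proof (rule cblinfun_eqI, rule cinner_right_unique)
  fix x y
  show "cinner x (adj T y) = cinner x (S y)"
    using cinner_adj[of T x y] S[of x y] by (rule trans[OF sym])
qed

lemma adj_add: "adj (S + T) = adj S + adj T"
  by (rule adj_unique) (simp add: plus_cblinfun.rep_eq cinner_add_left cinner_add_right cinner_adj)

lemma adj_scaleC: "adj (c *\<^sub>C T) = cnj c *\<^sub>C adj T"
  by (rule adj_unique)
    (simp add: scaleC_cblinfun.rep_eq cinner_scaleC_left cinner_scaleC_right cinner_adj)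

lemma adj_adj: "adj (adj T) = T"
proof (rule adj_unique)
  fix x y
  have "cinner (adj T x) y = cnj (cinner y (adj T x))" by (rule cinner_commute)
  also have "\<dots> = cnj (cinner (T y) x)" by (simp only: cinner_adj)
  also have "\<dots> = cinner x (T y)" by (rule cinner_commute[symmetric])
  finally show "cinner (adj T x) y = cinner x (T y)" .
qed

lemma adj_ccomp: "adj (S \<cdot> T) = adj T \<cdot> adj S"
  by (rule adj_unique) (simp add: ccomp.rep_eq cinner_adj)

lemma norm_adj_le: "norm (adj T) \<le> norm T"
proof (rule norm_cblinfun_bound)
  fix y
  show "norm (adj T y) \<le> norm T * norm y"
  proof (cases "norm (adj T y) = 0")
    case False
    have "cmod (cinner (T (adj T y)) y) = cmod (complex_of_real ((norm (adj T y))\<^sup>2))"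
      by (simp only: cinner_adj cinner_self)
    then have "(norm (adj T y))\<^sup>2 = cmod (cinner (T (adj T y)) y)"
      by (simp only: norm_of_real) simp
    also have "\<dots> \<le> norm (T (adj T y)) * norm y" by (rule cmod_cinner_le)
    also have "\<dots> \<le> norm T * norm (adj T y) * norm y"
      by (intro mult_right_mono norm_cblinfun norm_ge_zero)
    finally show ?thesis using False by (simp add: power2_eq_square)
  qed simp
qed simp


section \<open>The bidual of \<open>B(H)\<close>\<close>

type_synonym 'h op = "'h \<Rightarrow>\<^sub>c\<^sub>L 'h"
type_synonym 'a dual = "'a \<Rightarrow>\<^sub>c\<^sub>L complex"
type_synonym 'h op_bidual = "'h op dual dual"

lift_definition to_bidual :: "'a::complex_normed_vector \<Rightarrow> 'a dual dual"
  is "\<lambda>a \<phi>. cblinfun_apply \<phi> a"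
proof -
  fix a :: 'a
  show "bounded_linear (\<lambda>\<phi>::'a dual. \<phi> a) \<and>
      (\<forall>c (\<phi>::'a dual). cblinfun_apply (c *\<^sub>C \<phi>) a = c *\<^sub>C cblinfun_apply \<phi> a)"
    by (rule cblinfun_raw[where K="norm a"])
      (simp_all add: plus_cblinfun.rep_eq scaleC_cblinfun.rep_eq norm_cblinfun mult.commute[of "norm a"])
qed

text \<open>
  The Arens product, built in the usual three steps:
  \<open>(\<phi> \<cdot> S) T = \<phi> (S T)\<close>, then \<open>(n \<cdot> \<phi>) S = n (\<phi> \<cdot> S)\<close>, then \<open>(m n) \<phi> = m (n \<cdot> \<phi>)\<close>.
  This is the first Arens product; \<open>B(H)\<close> is Arens regular, so the second one coincides with it.
\<close>

lift_definition dual_act :: "('h::complex_normed_vector) op dual \<Rightarrow> 'h op \<Rightarrow> 'h op dual"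
  is "\<lambda>\<phi> S T. cblinfun_apply \<phi> (S \<cdot> T)"
proof -
  fix \<phi> :: "'h op dual" and S :: "'h op"
  show "bounded_linear (\<lambda>T. \<phi> (S \<cdot> T)) \<and> (\<forall>c T. \<phi> (S \<cdot> (c *\<^sub>C T)) = c *\<^sub>C \<phi> (S \<cdot> T))"
  proof (rule cblinfun_raw[where K="norm \<phi> * norm S"])
    fix T :: "'h op"
    have "norm (\<phi> (S \<cdot> T)) \<le> norm \<phi> * norm (S \<cdot> T)" by (rule norm_cblinfun)
    also have "\<dots> \<le> norm \<phi> * (norm S * norm T)" by (intro mult_left_mono norm_ccomp norm_ge_zero)
    finally show "norm (\<phi> (S \<cdot> T)) \<le> norm \<phi> * norm S * norm T" by (simp add: mult.assoc)
  qed (simp_all add: ccomp_add_right cblinfun_add ccomp_scaleC_right cblinfun_scaleC)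
qed

lemma norm_dual_act: "norm (dual_act \<phi> S) \<le> norm \<phi> * norm S"
proof (rule norm_cblinfun_bound)
  fix T
  have "norm (\<phi> (S \<cdot> T)) \<le> norm \<phi> * norm (S \<cdot> T)" by (rule norm_cblinfun)
  also have "\<dots> \<le> norm \<phi> * (norm S * norm T)" by (intro mult_left_mono norm_ccomp norm_ge_zero)
  finally show "norm (dual_act \<phi> S T) \<le> norm \<phi> * norm S * norm T"
    by (simp add: mult.assoc dual_act.rep_eq)
qed simp

lift_definition bidual_act :: "('h::complex_normed_vector) op_bidual \<Rightarrow> 'h op dual \<Rightarrow> 'h op dual"
  is "\<lambda>n \<phi> S. cblinfun_apply n (dual_act \<phi> S)"
proof -
  fix n :: "'h op_bidual" and \<phi> :: "'h op dual"
  have add: "dual_act \<phi> (S + T) = dual_act \<phi> S + dual_act \<phi> T" for S T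
    by (rule cblinfun_eqI)
      (simp add: dual_act.rep_eq plus_cblinfun.rep_eq ccomp_add_left cblinfun_add)
  have sc: "dual_act \<phi> (c *\<^sub>C S) = c *\<^sub>C dual_act \<phi> S" for c S
    by (rule cblinfun_eqI)
      (simp add: dual_act.rep_eq scaleC_cblinfun.rep_eq ccomp_scaleC_left cblinfun_scaleC)
  show "bounded_linear (\<lambda>S. n (dual_act \<phi> S)) \<and>
      (\<forall>c S. n (dual_act \<phi> (c *\<^sub>C S)) = c *\<^sub>C n (dual_act \<phi> S))"
  proof (rule cblinfun_raw[where K="norm n * norm \<phi>"])
    fix S :: "'h op"
    have "norm (n (dual_act \<phi> S)) \<le> norm n * norm (dual_act \<phi> S)" by (rule norm_cblinfun)
    also have "\<dots> \<le> norm n * (norm \<phi> * norm S)"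
      by (intro mult_left_mono norm_dual_act norm_ge_zero)
    finally show "norm (n (dual_act \<phi> S)) \<le> norm n * norm \<phi> * norm S" by (simp add: mult.assoc)
  qed (simp_all add: add sc cblinfun_add cblinfun_scaleC)
qed

lemma norm_bidual_act: "norm (bidual_act n \<phi>) \<le> norm n * norm \<phi>"
proof (rule norm_cblinfun_bound)
  fix S
  have "norm (n (dual_act \<phi> S)) \<le> norm n * norm (dual_act \<phi> S)" by (rule norm_cblinfun)
  also have "\<dots> \<le> norm n * (norm \<phi> * norm S)"
    by (intro mult_left_mono norm_dual_act norm_ge_zero)
  finally show "norm (bidual_act n \<phi> S) \<le> norm n * norm \<phi> * norm S"
    by (simp add: mult.assoc bidual_act.rep_eq)
qed simp

lift_definition arens :: "('h::complex_normed_vector) op_bidual \<Rightarrow> 'h op_bidual \<Rightarrow> 'h op_bidual"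
  (infixl "\<odot>" 70) is "\<lambda>m n \<phi>. cblinfun_apply m (bidual_act n \<phi>)"
proof -
  fix m n :: "'h op_bidual"
  have add: "bidual_act n (\<phi> + \<psi>) = bidual_act n \<phi> + bidual_act n \<psi>" for \<phi> \<psi>
  proof -
    have "dual_act (\<phi> + \<psi>) S = dual_act \<phi> S + dual_act \<psi> S" for S
      by (rule cblinfun_eqI) (simp add: dual_act.rep_eq plus_cblinfun.rep_eq)
    then show ?thesis
      by (intro cblinfun_eqI) (simp add: bidual_act.rep_eq plus_cblinfun.rep_eq cblinfun_add)
  qed
  have sc: "bidual_act n (c *\<^sub>C \<phi>) = c *\<^sub>C bidual_act n \<phi>" for c \<phi>
  proof -
    have "dual_act (c *\<^sub>C \<phi>) S = c *\<^sub>C dual_act \<phi> S" for S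
      by (rule cblinfun_eqI) (simp add: dual_act.rep_eq scaleC_cblinfun.rep_eq)
    then show ?thesis
      by (intro cblinfun_eqI) (simp add: bidual_act.rep_eq scaleC_cblinfun.rep_eq cblinfun_scaleC)
  qed
  show "bounded_linear (\<lambda>\<phi>. m (bidual_act n \<phi>)) \<and>
      (\<forall>c \<phi>. m (bidual_act n (c *\<^sub>C \<phi>)) = c *\<^sub>C m (bidual_act n \<phi>))"
  proof (rule cblinfun_raw[where K="norm m * norm n"])
    fix \<phi> :: "'h op dual"
    have "norm (m (bidual_act n \<phi>)) \<le> norm m * norm (bidual_act n \<phi>)" by (rule norm_cblinfun)
    also have "\<dots> \<le> norm m * (norm n * norm \<phi>)"
      by (intro mult_left_mono norm_bidual_act norm_ge_zero)
    finally show "norm (m (bidual_act n \<phi>)) \<le> norm m * norm n * norm \<phi>" by (simp add: mult.assoc)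
  qed (simp_all add: add sc cblinfun_add cblinfun_scaleC)
qed

lemma arens_to_bidual: "to_bidual S \<odot> to_bidual T = to_bidual (S \<cdot> T)"
  by (rule cblinfun_eqI)
    (simp add: arens.rep_eq to_bidual.rep_eq bidual_act.rep_eq dual_act.rep_eq)

text \<open>
  The involution of the von Neumann algebra \<open>B(H)\<^sup>*\<^sup>*\<close>: the weak* continuous extension of the
  adjoint, \<open>m\<^sup>* \<phi> = cnj (m \<phi>\<^sup>*)\<close> with \<open>\<phi>\<^sup>* T = cnj (\<phi> T\<^sup>*)\<close>.
\<close>

lift_definition dual_star :: "('h::complex_hilbert_space) op dual \<Rightarrow> 'h op dual"
  is "\<lambda>\<phi> T. cnj (cblinfun_apply \<phi> (adj T))"
proof -
  fix \<phi> :: "'h op dual"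
  show "bounded_linear (\<lambda>T. cnj (\<phi> (adj T))) \<and>
      (\<forall>c T. cnj (\<phi> (adj (c *\<^sub>C T))) = c *\<^sub>C cnj (\<phi> (adj T)))"
  proof (rule cblinfun_raw[where K="norm \<phi>"])
    fix T :: "'h op"
    have "norm (\<phi> (adj T)) \<le> norm \<phi> * norm (adj T)" by (rule norm_cblinfun)
    also have "\<dots> \<le> norm \<phi> * norm T" by (intro mult_left_mono norm_adj_le norm_ge_zero)
    finally show "norm (cnj (\<phi> (adj T))) \<le> norm \<phi> * norm T" by simp
  qed (simp_all add: adj_add adj_scaleC cblinfun_add cblinfun_scaleC scaleC_complex_def)
qed

lift_definition bidual_star :: "('h::complex_hilbert_space) op_bidual \<Rightarrow> 'h op_bidual"
  is "\<lambda>m \<phi>. cnj (cblinfun_apply m (dual_star \<phi>))"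
proof -
  fix m :: "'h op_bidual"
  have add: "dual_star (\<phi> + \<psi>) = dual_star \<phi> + dual_star \<psi>" for \<phi> \<psi> :: "'h op dual"
    by (rule cblinfun_eqI) (simp add: dual_star.rep_eq plus_cblinfun.rep_eq)
  have sc: "dual_star (c *\<^sub>C \<phi>) = cnj c *\<^sub>C dual_star \<phi>" for c and \<phi> :: "'h op dual"
    by (rule cblinfun_eqI) (simp add: dual_star.rep_eq scaleC_cblinfun.rep_eq scaleC_complex_def)
  have nrm: "norm (dual_star \<phi>) \<le> norm \<phi>" for \<phi> :: "'h op dual"
  proof (rule norm_cblinfun_bound)
    fix T
    have "norm (\<phi> (adj T)) \<le> norm \<phi> * norm (adj T)" by (rule norm_cblinfun)
    also have "\<dots> \<le> norm \<phi> * norm T" by (intro mult_left_mono norm_adj_le norm_ge_zero)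
    finally show "norm (dual_star \<phi> T) \<le> norm \<phi> * norm T" by (simp add: dual_star.rep_eq)
  qed simp
  show "bounded_linear (\<lambda>\<phi>. cnj (m (dual_star \<phi>))) \<and>
      (\<forall>c \<phi>. cnj (m (dual_star (c *\<^sub>C \<phi>))) = c *\<^sub>C cnj (m (dual_star \<phi>)))"
  proof (rule cblinfun_raw[where K="norm m"])
    fix \<phi> :: "'h op dual"
    have "norm (m (dual_star \<phi>)) \<le> norm m * norm (dual_star \<phi>)" by (rule norm_cblinfun)
    also have "\<dots> \<le> norm m * norm \<phi>" by (intro mult_left_mono nrm norm_ge_zero)
    finally show "norm (cnj (m (dual_star \<phi>))) \<le> norm m * norm \<phi>" by simp
  qed (simp_all add: add sc cblinfun_add cblinfun_scaleC scaleC_complex_def)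
qed

lemma bidual_star_to_bidual: "bidual_star (to_bidual T) = to_bidual (adj T)"
  by (rule cblinfun_eqI) (simp add: bidual_star.rep_eq to_bidual.rep_eq dual_star.rep_eq)


section \<open>Operator algebras and open projections\<close>

definition operator_algebra :: "('h::complex_hilbert_space) op set \<Rightarrow> bool"
  where "operator_algebra A \<longleftrightarrow>
    closed A \<and> 0 \<in> A \<and> (\<forall>S\<in>A. \<forall>T\<in>A. S + T \<in> A) \<and> (\<forall>c. \<forall>T\<in>A. c *\<^sub>C T \<in> A) \<and>
    (\<forall>S\<in>A. \<forall>T\<in>A. S \<cdot> T \<in> A)"

definition is_identity :: "('h::complex_hilbert_space) op set \<Rightarrow> 'h op \<Rightarrow> bool"
  where "is_identity A e \<longleftrightarrow> e \<in> A \<and> (\<forall>T\<in>A. e \<cdot> T = T \<and> T \<cdot> e = T)"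

definition unitization :: "('h::complex_hilbert_space) op set \<Rightarrow> 'h op set"
  where "unitization A =
    (if \<exists>e. is_identity A e \<and> norm e = 1 then A else {T + c *\<^sub>C cid | T c. T \<in> A})"

definition unitization_one :: "('h::complex_hilbert_space) op set \<Rightarrow> 'h op"
  where "unitization_one A = (THE e. is_identity (unitization A) e)"

lemma is_identity_unique: "is_identity A e \<Longrightarrow> is_identity A e' \<Longrightarrow> e = e'"
  unfolding is_identity_def by metis

lemma is_identity_unitization_one:
  assumes A: "operator_algebra A"
  shows "is_identity (unitization A) (unitization_one A)"
proof -
  have "\<exists>e. is_identity (unitization A) e"
  proof (cases "\<exists>e. is_identity A e \<and> norm e = 1")
    case True
    then have "unitization A = A" by (simp add: unitization_def)
    with True show ?thesis by auto
  next
    case False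
    then have U: "unitization A = {T + c *\<^sub>C cid | T c. T \<in> A}" unfolding unitization_def by (rule if_not_P)
    have "0 \<in> A" using A by (simp add: operator_algebra_def)
    then have "0 + 1 *\<^sub>C cid \<in> unitization A" unfolding U by blast
    then have "is_identity (unitization A) cid" by (simp add: is_identity_def)
    then show ?thesis ..
  qed
  then have "\<exists>!e. is_identity (unitization A) e"
    by (rule ex_ex1I) (rule is_identity_unique)
  then show ?thesis unfolding unitization_one_def by (rule theI')
qed

text \<open>
  \<open>A\<^sup>*\<^sup>*\<close> is realized as the double annihilator of \<open>A\<close>, i.e. as the weak* closure of \<open>A\<close>, inside
  \<open>B(H)\<^sup>*\<^sup>*\<close>; this is the image of the (isometric, multiplicative) second adjoint of the inclusion
  of \<open>A\<close> into \<open>B(H)\<close>.  In the same way \<open>(A\<^sup>1)\<^sup>*\<^sup>*\<close> is \<open>bidual (unitization A)\<close>, so products and norms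
  in \<open>A\<^sup>*\<^sup>*\<close> and \<open>(A\<^sup>1)\<^sup>*\<^sup>*\<close> are those of \<open>B(H)\<^sup>*\<^sup>*\<close>.
\<close>

definition bidual :: "('h::complex_hilbert_space) op set \<Rightarrow> 'h op_bidual set"
  where "bidual A =
    {m. \<forall>\<phi>. (\<forall>T\<in>A. cblinfun_apply \<phi> T = 0) \<longrightarrow> cblinfun_apply m \<phi> = 0}"

lemma to_bidual_in_bidual: "T \<in> A \<Longrightarrow> to_bidual T \<in> bidual A"
  by (simp add: bidual_def to_bidual.rep_eq)

lemma bidual_mono: "A \<subseteq> B \<Longrightarrow> bidual A \<subseteq> bidual B"
  by (auto simp: bidual_def)

lemma subset_unitization: "A \<subseteq> unitization A"
proof
  fix T assume "T \<in> A"
  moreover from this have "T + 0 *\<^sub>C cid \<in> {T + c *\<^sub>C cid | T c. T \<in> A}" by blast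
  moreover have "T + 0 *\<^sub>C cid = T" using scaleC_of_real[of 0 "cid :: 'a op"] by simp
  ultimately show "T \<in> unitization A" by (simp add: unitization_def)
qed

lemma bidual_add: "m \<in> bidual A \<Longrightarrow> n \<in> bidual A \<Longrightarrow> m + n \<in> bidual A"
  by (simp add: bidual_def plus_cblinfun.rep_eq)

lemma bidual_scaleC: "m \<in> bidual A \<Longrightarrow> c *\<^sub>C m \<in> bidual A"
  by (simp add: bidual_def scaleC_cblinfun.rep_eq scaleC_complex_def)

lemma bidual_arens:
  assumes A: "operator_algebra A" and m: "m \<in> bidual A" and n: "n \<in> bidual A"
  shows "m \<odot> n \<in> bidual A"
proof -
  have "m (bidual_act n \<phi>) = 0" if \<phi>: "\<forall>T\<in>A. \<phi> T = 0" for \<phi> :: "'a op dual"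
  proof -
    have "bidual_act n \<phi> S = 0" if S: "S \<in> A" for S
    proof -
      have "\<forall>T\<in>A. dual_act \<phi> S T = 0"
        using A S \<phi> by (simp add: dual_act.rep_eq operator_algebra_def)
      then show ?thesis using n by (simp add: bidual_act.rep_eq bidual_def)
    qed
    then show ?thesis using m by (simp add: bidual_def)
  qed
  then show ?thesis by (simp add: bidual_def arens.rep_eq)
qed

definition bidual_one :: "('h::complex_hilbert_space) op set \<Rightarrow> 'h op_bidual"
  where "bidual_one A = to_bidual (unitization_one A)"

definition projection :: "('h::complex_hilbert_space) op_bidual \<Rightarrow> bool"
  where "projection p \<longleftrightarrow> p \<odot> p = p \<and> bidual_star p = p"

definition weak_star_tendsto ::
    "('i \<Rightarrow> ('a::complex_normed_vector) dual) \<Rightarrow> 'a dual \<Rightarrow> 'i filter \<Rightarrow> bool"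
  where "weak_star_tendsto f m F \<longleftrightarrow> (\<forall>x. ((\<lambda>i. f i x) \<longlongrightarrow> m x) F)"

text \<open>
  A net in \<open>A\<close> is represented by its filter of tails, a proper filter on the space of operators;
  conversely every proper filter is the filter of tails of a net.
\<close>

definition open_projection :: "('h::complex_hilbert_space) op set \<Rightarrow> 'h op_bidual \<Rightarrow> bool"
  where "open_projection A p \<longleftrightarrow> p \<in> bidual A \<and> projection p \<and>
    (\<exists>F :: 'h op filter. F \<noteq> bot \<and>
      (\<forall>\<^sub>F x in F. x \<in> A \<and> to_bidual x = p \<odot> to_bidual x) \<and> weak_star_tendsto to_bidual p F)"

end

theory Submission
  imports Defs
begin

text \<open>
  Let \<open>D = {d \<in> A. p d = d = d p}\<close>. As \<open>b\<close> commutes with \<open>p\<close>, every \<open>g \<in> b + D\<close> satisfies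
  \<open>g (1 - p) = (1 - p) g = b (1 - p)\<close>, so the task is to find an element of norm at most \<open>1\<close> in the
  coset \<open>b + D\<close>. Its existence reflects that \<open>D\<close> is an M-ideal in the algebra of elements of \<open>A\<close> that
  commute with \<open>p\<close>, and M-ideals are proximinal; the proof below makes this explicit.

  The element of the coset is the limit of a sequence. Suppose \<open>x \<in> b + D\<close> has norm at most \<open>1 + e\<close>. In
  the bidual, \<open>x (1 - p) + t x p\<close> with \<open>t = 1 / (1 + e)\<close> has norm at most \<open>1\<close>, because \<open>p\<close> is a
  projection that commutes with \<open>x\<close>, and it differs from \<open>x\<close> by the element \<open>m = (t - 1) x p\<close> of
  \<open>D\<^sup>*\<^sup>*\<close>, whose norm is at most \<open>e\<close>. A Hahn-Banach argument replaces \<open>m\<close> by some \<open>j \<in> D\<close> with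
  \<open>|j| < 2 e\<close> and \<open>|x + j| < 1 + e / 2\<close>. This is \<open>shrink_modulo_hereditary_subalgebra\<close>; iterating
  it gives a Cauchy sequence whose limit is \<open>g\<close>.

  Three ingredients carry this argument.

  \<^item> \<open>simultaneous_approximation\<close>: norm conditions that an element of \<open>J\<^sup>\<bottom>\<^sup>\<bottom>\<close> satisfies with room to
    spare are satisfied, two at a time, by an element of the subspace \<open>J\<close> itself.

  \<^item> \<open>bidual_cstar_inequality\<close>: \<open>|m|\<^sup>2 \<le> |m\<^sup>* m|\<close> in \<open>B(H)\<^sup>*\<^sup>*\<close> with the Arens product. It is proved
    without representing the bidual on a Hilbert space: every functional \<open>\<phi>\<close> of norm at most \<open>1\<close> is
    dominated by a positive one, \<open>|\<phi> T|\<^sup>2 \<le> \<psi> (T\<^sup>* T)\<close>, and this inequality extends to the bidual by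
    approximate Riesz representation for the semi-inner product \<open>\<psi> (S\<^sup>* T)\<close>.

  \<^item> \<open>open_projection_in_bidual_hereditary_subalgebra\<close>: \<open>p\<close> lies in \<open>D\<^sup>*\<^sup>*\<close>, although openness only
    provides a net with the one-sided condition \<open>x\<^sub>t = p x\<^sub>t\<close>. Since \<open>p\<close> is self-adjoint, it is also
    a weak* limit of operators \<open>T\<close> with \<open>T p = T\<close>. Hence there are \<open>T \<in> A\<close> with \<open>p T = T\<close> for which
    \<open>|T (1 - p)|\<close> is as small as desired, and suitable infinite products of these lie in \<open>D\<close>.
\<close>

section \<open>The Hahn-Banach theorem for convex cones\<close>

text \<open>
  Think of \<open>(v, r) \<in> K\<close> as the demand \<open>f v \<le> r\<close>. The convex cone generated by the demands must not
  contain a contradictory demand \<open>f 0 \<le> r\<close> with \<open>r < 0\<close>, and this is the only obstruction. In a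
  maximal such cone the best bounds \<open>Inf {r. (v, r) \<in> M}\<close> form a linear functional. Compared with the
  version for sublinear functionals, this form spares the computation of infima in the applications.
\<close>
lemma hahn_banach_cone:
  fixes K :: "('a::real_vector \<times> real) set"
  assumes K_add: "\<And>u v. u \<in> K \<Longrightarrow> v \<in> K \<Longrightarrow> u + v \<in> K"
    and K_scale: "\<And>t u. 0 \<le> t \<Longrightarrow> u \<in> K \<Longrightarrow> t *\<^sub>R u \<in> K"
    and K_zero: "\<And>r. (0, r) \<in> K \<Longrightarrow> 0 \<le> r"
    and K_total: "\<And>v. \<exists>r. (v, r) \<in> K"
  shows "\<exists>f. linear f \<and> (\<forall>v r. (v, r) \<in> K \<longrightarrow> f v \<le> r)"
proof -
  define \<A> where "\<A> = {M. K \<subseteq> M \<and> (\<forall>u\<in>M. \<forall>v\<in>M. u + v \<in> M) \<and>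
    (\<forall>t\<ge>0. \<forall>u\<in>M. t *\<^sub>R u \<in> M) \<and> (\<forall>r. (0, r) \<in> M \<longrightarrow> 0 \<le> r)}"
  have "\<exists>M\<in>\<A>. \<forall>X\<in>\<A>. M \<subseteq> X \<longrightarrow> X = M"
  proof (rule subset_Zorn_nonempty)
    have "K \<in> \<A>" using assms by (simp add: \<A>_def)
    then show "\<A> \<noteq> {}" by blast
  next
    fix \<C> assume ne: "\<C> \<noteq> {}" and ch: "subset.chain \<A> \<C>"
    have sub: "\<C> \<subseteq> \<A>" and tot: "\<And>X Y. X \<in> \<C> \<Longrightarrow> Y \<in> \<C> \<Longrightarrow> X \<subseteq> Y \<or> Y \<subseteq> X"
      using ch by (auto simp: subset_chain_def)
    have "u + v \<in> \<Union>\<C>" if uv: "u \<in> \<Union>\<C>" "v \<in> \<Union>\<C>" for u v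
    proof -
      obtain X where X: "X \<in> \<C>" "u \<in> X" "v \<in> X" 
      proof -
        obtain Y Z where "Y \<in> \<C>" "u \<in> Y" "Z \<in> \<C>" "v \<in> Z" using uv by blast
        then show ?thesis using tot[of Y Z] that by blast
      qed
      then have "u + v \<in> X" using sub by (auto simp: \<A>_def)
      then show ?thesis using X by blast
    qed
    moreover have "K \<subseteq> \<Union>\<C>"
    proof -
      obtain X where "X \<in> \<C>" using ne by blast
      moreover from this have "K \<subseteq> X" using sub by (auto simp: \<A>_def)
      ultimately show ?thesis by blast
    qed
    moreover have "t *\<^sub>R u \<in> \<Union>\<C>" if "0 \<le> t" "u \<in> \<Union>\<C>" for t u
      using that sub by (auto simp: \<A>_def)
    moreover have "0 \<le> r" if "(0, r) \<in> \<Union>\<C>" for r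
      using that sub by (auto simp: \<A>_def)
    ultimately show "\<Union>\<C> \<in> \<A>" by (simp add: \<A>_def)
  qed
  then obtain M where M: "M \<in> \<A>" and M_max: "\<And>X. X \<in> \<A> \<Longrightarrow> M \<subseteq> X \<Longrightarrow> X = M" by blast
  have KM: "K \<subseteq> M" and M_add: "\<And>u v. u \<in> M \<Longrightarrow> v \<in> M \<Longrightarrow> u + v \<in> M"
    and M_scale: "\<And>t u. 0 \<le> t \<Longrightarrow> u \<in> M \<Longrightarrow> t *\<^sub>R u \<in> M"
    and M_zero: "\<And>r. (0, r) \<in> M \<Longrightarrow> 0 \<le> r"
    using M by (auto simp: \<A>_def)
  define f where "f v = Inf {r. (v, r) \<in> M}" for v
  have M_total: "{r. (v, r) \<in> M} \<noteq> {}" for v using K_total KM by blast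
  have bdd: "bdd_below {r. (v, r) \<in> M}" for v
  proof -
    obtain s where s: "(- v, s) \<in> M" using K_total KM by blast
    have "- s \<le> r" if "(v, r) \<in> M" for r
      using M_zero[of "r + s"] M_add[OF that s] by simp
    then show ?thesis by (intro bdd_belowI[of _ "- s"]) simp
  qed
  have f_le: "f v \<le> r" if "(v, r) \<in> M" for v r
    unfolding f_def using that by (intro cInf_lower bdd) simp
  \<comment> \<open>Adjoining the ray through \<open>(- v, - f v)\<close> to \<open>M\<close> keeps all the defining properties, so maximality
    puts it into \<open>M\<close>; this makes the sublinear function \<open>f\<close> odd.\<close>
  have f_neg_mem: "(- v, - f v) \<in> M" for v
  proof -
    define w where "w = (- v, - f v)"
    define X where "X = {u + t *\<^sub>R w | u t. u \<in> M \<and> 0 \<le> t}"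
    have MX: "M \<subseteq> X"
    proof
      fix u assume "u \<in> M"
      then have "u + 0 *\<^sub>R w \<in> X" unfolding X_def by blast
      then show "u \<in> X" by simp
    qed
    have "x + y \<in> X" if xy: "x \<in> X" "y \<in> X" for x y
    proof -
      obtain u s u' s' where "x = u + s *\<^sub>R w" "y = u' + s' *\<^sub>R w" "u \<in> M" "u' \<in> M" "0 \<le> s" "0 \<le> s'"
        using xy by (auto simp: X_def)
      then have "x + y = (u + u') + (s + s') *\<^sub>R w \<and> u + u' \<in> M \<and> 0 \<le> s + s'"
        using M_add by (simp add: algebra_simps)
      then show ?thesis unfolding X_def by blast
    qed
    moreover have "c *\<^sub>R x \<in> X" if x: "x \<in> X" and c: "0 \<le> c" for x c
    proof -
      obtain u s where "x = u + s *\<^sub>R w" "u \<in> M" "0 \<le> s"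
        using x by (auto simp: X_def)
      then have "c *\<^sub>R x = c *\<^sub>R u + (c * s) *\<^sub>R w \<and> c *\<^sub>R u \<in> M \<and> 0 \<le> c * s"
        using M_scale c by (simp add: algebra_simps)
      then show ?thesis unfolding X_def by blast
    qed
    moreover have "0 \<le> r" if r: "(0, r) \<in> X" for r
    proof -
      obtain u t where u: "(0, r) = u + t *\<^sub>R w" "u \<in> M" and t: "0 \<le> t"
        using r by (auto simp: X_def)
      have u': "(t *\<^sub>R v, r + t * f v) \<in> M"
      proof -
        have "u = (0, r) - t *\<^sub>R w" using u(1) by simp
        then show ?thesis using u(2) by (simp add: w_def)
      qed
      show ?thesis
      proof (cases "t = 0")
        case True
        then show ?thesis using u' M_zero by simp
      next
        case False
        then have "t > 0" using t by simp
        then have "(1 / t) *\<^sub>R (t *\<^sub>R v, r + t * f v) \<in> M" by (intro M_scale u') simp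
        then have "(v, (r + t * f v) / t) \<in> M" using False by simp
        then have "f v \<le> (r + t * f v) / t" by (rule f_le)
        then show ?thesis using \<open>t > 0\<close> by (simp add: field_simps)
      qed
    qed
    ultimately have "X \<in> \<A>" using KM MX by (auto simp: \<A>_def)
    then have "X = M" using MX by (rule M_max)
    moreover have "w \<in> X"
    proof -
      obtain u where "u \<in> M" using M_total by blast
      from M_scale[OF order_refl this] have "0 + 1 *\<^sub>R w \<in> X"
        unfolding X_def by (intro CollectI exI[of _ 0] exI[of _ 1]) (simp add: zero_prod_def)
      then show ?thesis by simp
    qed
    ultimately show ?thesis by (simp add: w_def)
  qed
  have f_minus: "f (- v) = - f v" for v
  proof (rule antisym)
    show "f (- v) \<le> - f v" by (rule f_le[OF f_neg_mem])
    have "- s \<le> f v" if "(- v, s) \<in> M" for s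
      unfolding f_def
    proof (rule cInf_greatest[OF M_total])
      fix r assume "r \<in> {r. (v, r) \<in> M}"
      then show "- s \<le> r" using M_zero[of "r + s"] M_add[of "(v, r)" "(- v, s)"] that by simp
    qed
    then show "- f v \<le> f (- v)"
      unfolding f_def[of "- v"] by (intro cInf_greatest[OF M_total]) force
  qed
  have f_mem: "(v, f v) \<in> M" for v
    using f_neg_mem[of "- v"] by (simp add: f_minus)
  have f_sub: "f (u + v) \<le> f u + f v" for u v
    using f_le M_add[OF f_mem[of u] f_mem[of v]] by simp
  have f_add: "f (u + v) = f u + f v" for u v
    using f_sub[of u v] f_sub[of "- u" "- v"] f_minus[of "u + v"] f_minus[of u] f_minus[of v] by simp
  have f_pos: "f (t *\<^sub>R v) = t * f v" if "0 \<le> t" for t v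
  proof (rule antisym)
    have le: "f (t *\<^sub>R w) \<le> t * f w" for w
      using f_le M_scale[OF that f_mem[of w]] by simp
    show "f (t *\<^sub>R v) \<le> t * f v" by (rule le)
    show "t * f v \<le> f (t *\<^sub>R v)" using le[of "- v"] by (simp add: f_minus)
  qed
  have "f (t *\<^sub>R v) = t * f v" for t v
    using f_pos[of t v] f_pos[of "- t" v] f_minus[of "t *\<^sub>R v"] by (cases "0 \<le> t") auto
  then have "linear f" using f_add by (intro linearI) simp_all
  then show ?thesis using f_le KM by blast
qed

text \<open>
  The usual passage from a real functional \<open>f\<close> to the complex functional with real part \<open>f\<close>.
\<close>
lemma real_linear_complexify:
  fixes f :: "'a::complex_normed_vector \<Rightarrow> real"
  assumes lin: "linear f" and bound: "\<And>x. f x \<le> C * norm x"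
  shows "\<exists>\<phi> :: 'a dual. (\<forall>x. \<phi> x = Complex (f x) (- f (\<i> *\<^sub>C x)))"
proof -
  note f = linear_add[OF lin] linear_scale[OF lin] linear_neg[OF lin] linear_diff[OF lin]
  have abs: "\<bar>f x\<bar> \<le> C * norm x" for x
    using bound[of x] bound[of "- x"] by (simp add: f)
  define g where "g x = Complex (f x) (- f (\<i> *\<^sub>C x))" for x
  have "bounded_linear g \<and> (\<forall>c x. g (c *\<^sub>C x) = c *\<^sub>C g x)"
  proof (rule cblinfun_raw[where K="2 * C"])
    show "g (x + y) = g x + g y" for x y
      by (simp add: g_def complex_eq_iff scaleC_add_right f)
    show "g (c *\<^sub>C x) = c *\<^sub>C g x" for c x
    proof -
      have "c *\<^sub>C x = Re c *\<^sub>R x + Im c *\<^sub>R (\<i> *\<^sub>C x)"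
        by (subst complex_eq[of c])
          (simp only: scaleC_add_left scaleC_of_real[symmetric] scaleC_scaleC mult.commute)
      moreover from this have "\<i> *\<^sub>C (c *\<^sub>C x) = Re c *\<^sub>R (\<i> *\<^sub>C x) + Im c *\<^sub>R (- x)"
        using scaleC_of_real[of "-1" x]
        by (simp add: scaleC_add_right scaleC_scaleR scaleC_scaleC)
      ultimately show ?thesis
        by (simp add: g_def complex_eq_iff f scaleC_complex_def)
    qed
    show "norm (g x) \<le> 2 * C * norm x" for x
      using cmod_le[of "g x"] abs[of x] abs[of "\<i> *\<^sub>C x"] by (simp add: g_def norm_scaleC)
  qed
  then have "cblinfun_apply (CBlinfun g) = g" by (simp add: CBlinfun_inverse)
  then show ?thesis by (intro exI[of _ "CBlinfun g"]) (simp add: g_def)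
qed

lemma complex_rotate: "\<exists>u. cmod u = 1 \<and> u * z = complex_of_real (cmod z)"
proof (cases "z = 0")
  case False
  have "cnj z / cmod z * z = complex_of_real (cmod z)"
    using False complex_norm_square[of z] by (simp add: field_simps power2_eq_square)
  moreover have "cmod (cnj z / cmod z) = 1" using False by (simp add: norm_divide)
  ultimately show ?thesis by blast
qed (auto intro: exI[of _ 1])

section \<open>Approximating elements of the second annihilator\<close>

lemma cblinfun_zero: "cblinfun_apply T 0 = 0"
  using cblinfun_diff[of T 0 0] by simp

lemma linear_prod_split:
  assumes "linear (f :: 'a::real_vector \<times> 'b::real_vector \<Rightarrow> real)"
  shows "f (a, c) = f (a, 0) + f (0, c)" "linear (\<lambda>a. f (a, 0))" "linear (\<lambda>c. f (0, c))"
proof -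
  note f = linear_add[OF assms] linear_scale[OF assms]
  show "f (a, c) = f (a, 0) + f (0, c)" using f(1)[of "(a, 0)" "(0, c)"] by simp
  have "f (x + y, 0) = f (x, 0) + f (y, 0)" for x y using f(1)[of "(x, 0)" "(y, 0)"] by simp
  moreover have "f (r *\<^sub>R x, 0) = r * f (x, 0)" for r x using f(2)[of r "(x, 0)"] by simp
  ultimately show "linear (\<lambda>a. f (a, 0))" by (intro linearI) simp_all
  have "f (0, x + y) = f (0, x) + f (0, y)" for x y using f(1)[of "(0, x)" "(0, y)"] by simp
  moreover have "f (0, r *\<^sub>R x) = r * f (0, x)" for r x using f(2)[of r "(0, x)"] by simp
  ultimately show "linear (\<lambda>c. f (0, c))" by (intro linearI) simp_all
qed

lemma norm_cblinfun_bound_ball: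
  assumes "0 < r" and le: "\<And>x. norm x \<le> r \<Longrightarrow> norm (cblinfun_apply T x) \<le> C"
  shows "r * norm T \<le> C"
proof -
  have "0 \<le> C" using order_trans[OF norm_ge_zero le[of 0]] \<open>0 < r\<close> by simp
  have "norm T \<le> C / r"
  proof (rule norm_cblinfun_bound)
    fix x
    show "norm (T x) \<le> C / r * norm x"
    proof (cases "x = 0")
      case True
      then show ?thesis by (simp add: cblinfun_zero)
    next
      case False
      define s where "s = r / norm x"
      have s: "0 < s" using False \<open>0 < r\<close> by (simp add: s_def)
      have "norm (T (complex_of_real s *\<^sub>C x)) \<le> C"
        using False \<open>0 < r\<close> by (intro le) (simp add: s_def norm_scaleC norm_divide)
      then have "s * norm (T x) \<le> C" using s by (simp add: cblinfun_scaleC norm_scaleC)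
      then show ?thesis using False \<open>0 < r\<close> by (simp add: s_def field_simps)
    qed
  qed (use \<open>0 \<le> C\<close> \<open>0 < r\<close> in simp)
  then show ?thesis using \<open>0 < r\<close> by (simp add: field_simps)
qed

definition complex_subspace :: "'a::complex_normed_vector set \<Rightarrow> bool"
  where "complex_subspace J \<longleftrightarrow> 0 \<in> J \<and> (\<forall>x\<in>J. \<forall>y\<in>J. x + y \<in> J) \<and> (\<forall>c. \<forall>x\<in>J. c *\<^sub>C x \<in> J)"

text \<open>
  The hypotheses say that \<open>L\<^sub>i\<^sup>*\<^sup>* m + x\<^sub>i\<close> has norm at most \<open>s\<^sub>i\<close> in the bidual, where \<open>m \<in> J\<^sup>\<bottom>\<^sup>\<bottom>\<close>; the
  second adjoints are spelled out on functionals. If no \<open>j \<in> J\<close> were as required, then in the product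
  space with norm \<open>max (|a| / r1) (|c| / r2)\<close> the point \<open>(x1, x2)\<close> would have distance at least \<open>1\<close>
  from the subspace \<open>{(L1 j, L2 j) | j. j \<in> J}\<close>. A separating functional \<open>(g1, g2)\<close> has
  \<open>r1 |g1| + r2 |g2| \<le> 1\<close>, and \<open>g1 \<circ> L1 + g2 \<circ> L2\<close> vanishes on \<open>J\<close>, hence at \<open>m\<close>. Evaluating at
  \<open>(x1, x2)\<close> then gives \<open>1 \<le> s1 |g1| + s2 |g2| < 1\<close>.
\<close>
lemma simultaneous_approximation:
  fixes J :: "'a::complex_normed_vector set" and m :: "'a dual dual"
    and L1 :: "'a \<Rightarrow>\<^sub>c\<^sub>L 'b::complex_normed_vector" and L2 :: "'a \<Rightarrow>\<^sub>c\<^sub>L 'c::complex_normed_vector"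
  assumes J: "complex_subspace J"
    and m: "\<And>\<phi>. \<forall>x\<in>J. cblinfun_apply \<phi> x = 0 \<Longrightarrow> m \<phi> = 0"
    and m1: "\<And>\<phi> :: 'b dual. cmod (m (\<phi> \<cdot> L1) + \<phi> x1) \<le> s1 * norm \<phi>" and s1: "0 \<le> s1" "s1 < r1"
    and m2: "\<And>\<phi> :: 'c dual. cmod (m (\<phi> \<cdot> L2) + \<phi> x2) \<le> s2 * norm \<phi>" and s2: "0 \<le> s2" "s2 < r2"
  shows "\<exists>j\<in>J. norm (L1 j + x1) < r1 \<and> norm (L2 j + x2) < r2"
proof (rule ccontr)
  assume no: "\<not> ?thesis"
  have r: "0 < r1" "0 < r2" using s1 s2 by auto
  have J0: "0 \<in> J" and J_add: "\<And>x y. x \<in> J \<Longrightarrow> y \<in> J \<Longrightarrow> x + y \<in> J"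
    and J_scale: "\<And>c x. x \<in> J \<Longrightarrow> c *\<^sub>C x \<in> J"
    using J by (auto simp: complex_subspace_def)
  have J_scaleR: "c *\<^sub>R x \<in> J" if "x \<in> J" for c x
    using J_scale[OF that, of "complex_of_real c"] by (simp add: scaleC_of_real)
  have L_scaleR: "L1 (c *\<^sub>R x) = c *\<^sub>R L1 x" "L2 (c *\<^sub>R x) = c *\<^sub>R L2 x" for c x
    using cblinfun_scaleC[of L1 "complex_of_real c" x] cblinfun_scaleC[of L2 "complex_of_real c" x]
    by (simp_all add: scaleC_of_real)
  have L_zero: "L1 0 = 0" "L2 0 = 0" using L_scaleR[of 0 0] by auto
  define N where "N = (\<lambda>(a :: 'b, c :: 'c). max (norm a / r1) (norm c / r2))"
  have N_add: "N (u + v) \<le> N u + N v" for u v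
  proof -
    obtain a c a' c' where uv: "u = (a, c)" "v = (a', c')" by (cases u, cases v) auto
    have "norm (a + a') / r1 \<le> norm a / r1 + norm a' / r1"
      "norm (c + c') / r2 \<le> norm c / r2 + norm c' / r2"
      using r by (simp_all add: add_divide_distrib[symmetric] divide_right_mono norm_triangle_ineq)
    then show ?thesis by (auto simp: uv N_def)
  qed
  have N_scale: "N (t *\<^sub>R u) = t * N u" if "0 \<le> t" for t u
    using that by (cases u) (simp add: N_def max_mult_distrib_left)
  define x where "x = (x1, x2)"
  define L where "L j = (L1 j, L2 j)" for j
  have L_add: "L (i + j) = L i + L j" for i j by (simp add: L_def cblinfun_add)
  have L_scale: "L (t *\<^sub>R j) = t *\<^sub>R L j" for t j by (simp add: L_def L_scaleR)
  have far: "t \<le> N (L j + t *\<^sub>R x)" if "j \<in> J" "0 \<le> t" for j t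
  proof (cases "t = 0")
    case True
    then show ?thesis using r by (auto simp: N_def split_beta le_max_iff_disj)
  next
    case False
    then have t: "0 < t" using that by simp
    define i where "i = (1 / t) *\<^sub>R j"
    have "i \<in> J" using that J_scaleR by (simp add: i_def)
    then have "r1 \<le> norm (L1 i + x1) \<or> r2 \<le> norm (L2 i + x2)" using no by force
    then have "1 \<le> N (L i + x)" using r by (auto simp: N_def L_def x_def le_max_iff_disj)
    then have "t * 1 \<le> t * N (L i + x)" using t by (intro mult_left_mono) auto
    also have "\<dots> = N (t *\<^sub>R (L i + x))" using t by (simp add: N_scale)
    also have "t *\<^sub>R (L i + x) = L j + t *\<^sub>R x"
      using t by (simp add: i_def L_scale scaleR_add_right)
    finally show ?thesis by simp
  qed
  \<comment> \<open>The demands \<open>f (v + L j + t x) \<le> N (v + L j + t x)\<close> for a functional \<open>f\<close> that vanishes on the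
    range of \<open>L\<close> on \<open>J\<close> and is at least \<open>1\<close> at \<open>x\<close>; the slack \<open>e\<close> makes the set closed under addition.\<close>
  define K where "K = {(v, N (v + L j + t *\<^sub>R x) - t + e) | v j t e. j \<in> J \<and> 0 \<le> t \<and> 0 \<le> e}"
  have "\<exists>f. linear f \<and> (\<forall>v r. (v, r) \<in> K \<longrightarrow> f v \<le> r)"
  proof (rule hahn_banach_cone)
    fix u v assume "u \<in> K" "v \<in> K"
    then obtain u' j t e v' j' t' e'
      where uv: "u = (u', N (u' + L j + t *\<^sub>R x) - t + e)" "v = (v', N (v' + L j' + t' *\<^sub>R x) - t' + e')"
        and mem: "j \<in> J" "0 \<le> t" "0 \<le> e" "j' \<in> J" "0 \<le> t'" "0 \<le> e'"
      unfolding K_def by blast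
    define d where "d = N (u' + L j + t *\<^sub>R x) + N (v' + L j' + t' *\<^sub>R x)
      - N (u' + v' + L (j + j') + (t + t') *\<^sub>R x)"
    have "0 \<le> d"
      using N_add[of "u' + L j + t *\<^sub>R x" "v' + L j' + t' *\<^sub>R x"]
      by (simp add: d_def L_add scaleR_add_left algebra_simps)
    moreover have "u + v = (u' + v', N (u' + v' + L (j + j') + (t + t') *\<^sub>R x) - (t + t') + (e + e' + d))"
      by (simp add: uv d_def)
    moreover have "j + j' \<in> J" using mem J_add by blast
    ultimately show "u + v \<in> K" unfolding K_def using mem
      by (intro CollectI exI[of _ "u' + v'"] exI[of _ "j + j'"] exI[of _ "t + t'"] exI[of _ "e + e' + d"])
        auto
  next
    fix c :: real and u assume c: "0 \<le> c" and "u \<in> K"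
    then obtain u' j t e where u: "u = (u', N (u' + L j + t *\<^sub>R x) - t + e)"
        and mem: "j \<in> J" "0 \<le> t" "0 \<le> e"
      unfolding K_def by blast
    have "c *\<^sub>R (u' + L j + t *\<^sub>R x) = c *\<^sub>R u' + L (c *\<^sub>R j) + (c * t) *\<^sub>R x"
      by (simp add: L_scale scaleR_add_right)
    then have "c *\<^sub>R u = (c *\<^sub>R u', N (c *\<^sub>R u' + L (c *\<^sub>R j) + (c * t) *\<^sub>R x) - c * t + c * e)"
      using N_scale[OF c, of "u' + L j + t *\<^sub>R x"] by (simp add: u algebra_simps)
    then show "c *\<^sub>R u \<in> K" unfolding K_def using mem c J_scaleR
      by (intro CollectI exI[of _ "c *\<^sub>R u'"] exI[of _ "c *\<^sub>R j"] exI[of _ "c * t"] exI[of _ "c * e"])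
        auto
  next
    fix \<rho> assume "(0, \<rho>) \<in> K"
    then obtain j t e where "\<rho> = N (L j + t *\<^sub>R x) - t + e" "j \<in> J" "0 \<le> t" "0 \<le> e"
      unfolding K_def by auto
    then show "0 \<le> \<rho>" using far[of j t] by simp
  next
    fix v
    have "(v, N (v + L 0 + 0 *\<^sub>R x) - 0 + 0) \<in> K" unfolding K_def using J0 by blast
    then show "\<exists>\<rho>. (v, \<rho>) \<in> K" by blast
  qed
  then obtain f where lin: "linear f" and fK: "\<And>v \<rho>. (v, \<rho>) \<in> K \<Longrightarrow> f v \<le> \<rho>" by blast
  have f_le: "f v \<le> N (v + L j + t *\<^sub>R x) - t" if "j \<in> J" "0 \<le> t" for v j t
  proof -
    have "(v, N (v + L j + t *\<^sub>R x) - t + 0) \<in> K"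
      unfolding K_def using that order_refl[of "0 :: real"] by blast
    then show ?thesis using fK by fastforce
  qed
  have L0: "L 0 = 0" by (simp add: L_def L_zero zero_prod_def)
  have N0: "N 0 = 0" by (simp add: N_def zero_prod_def)
  have fN: "f v \<le> N v" for v using f_le[OF J0 order_refl, of v] by (simp add: L0)
  have fx: "1 \<le> f x"
    using f_le[OF J0, of 1 "- x"] linear_neg[OF lin, of x] by (simp add: L0 N0)
  have fL: "f (L j) = 0" if "j \<in> J" for j
  proof -
    have "f (- L i) \<le> 0" if "i \<in> J" for i
      using f_le[OF that, of 0 "- L i"] by (simp add: N0)
    from this[OF that] this[OF J_scaleR[OF that, of "-1"]] show ?thesis
      by (simp only: L_scale linear_neg[OF lin] linear_scale[OF lin]) simp
  qed
  note split = linear_prod_split[OF lin]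
  have "f (a, 0) \<le> (1 / r1) * norm a" for a
    using fN[of "(a, 0)"] r by (simp add: N_def max_absorb1 zero_le_divide_iff)
  from real_linear_complexify[OF split(2) this] obtain g1 :: "'b dual"
    where g1: "\<And>a. g1 a = Complex (f (a, 0)) (- f (\<i> *\<^sub>C a, 0))" by blast
  have "f (0, c) \<le> (1 / r2) * norm c" for c
    using fN[of "(0, c)"] r by (simp add: N_def max_absorb2 zero_le_divide_iff)
  from real_linear_complexify[OF split(3) this] obtain g2 :: "'c dual"
    where g2: "\<And>c. g2 c = Complex (f (0, c)) (- f (0, \<i> *\<^sub>C c))" by blast
  have g12: "cmod (g1 a) + cmod (g2 c) \<le> 1" if "norm a \<le> r1" "norm c \<le> r2" for a c
  proof -
    obtain u w where u: "cmod u = 1" "u * g1 a = cmod (g1 a)" and w: "cmod w = 1" "w * g2 c = cmod (g2 c)"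
      using complex_rotate by meson
    have "cmod (g1 a) + cmod (g2 c) = Re (g1 (u *\<^sub>C a)) + Re (g2 (w *\<^sub>C c))"
      using u w by (simp add: cblinfun_scaleC scaleC_complex_def)
    also have "\<dots> = f (u *\<^sub>C a, w *\<^sub>C c)"
      by (simp add: g1 g2 split(1)[of "u *\<^sub>C a" "w *\<^sub>C c"])
    also have "\<dots> \<le> N (u *\<^sub>C a, w *\<^sub>C c)" by (rule fN)
    also have "\<dots> \<le> 1" using that u w r by (simp add: N_def norm_scaleC)
    finally show ?thesis .
  qed
  have "r2 * norm g2 \<le> 1 - r1 * norm g1"
  proof (rule norm_cblinfun_bound_ball[OF r(2)])
    fix c :: 'c assume c: "norm c \<le> r2"
    have "r1 * norm g1 \<le> 1 - cmod (g2 c)"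
      by (rule norm_cblinfun_bound_ball[OF r(1)]) (use g12[OF _ c] in \<open>simp add: algebra_simps\<close>)
    then show "norm (g2 c) \<le> 1 - r1 * norm g1" by simp
  qed
  then have dual_norm: "r1 * norm g1 + r2 * norm g2 \<le> 1" by simp
  have "m (g1 \<cdot> L1 + g2 \<cdot> L2) = 0"
  proof (rule m, rule ballI)
    fix j assume j: "j \<in> J"
    have "f (L1 i, 0) + f (0, L2 i) = 0" if "i \<in> J" for i
      using fL[OF that] split(1)[of "L1 i" "L2 i"] by (simp add: L_def)
    from this[OF j] this[OF J_scale[OF j, of \<i>]]
    show "(g1 \<cdot> L1 + g2 \<cdot> L2) j = 0"
      by (simp add: plus_cblinfun.rep_eq ccomp.rep_eq g1 g2 complex_eq_iff cblinfun_scaleC)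
  qed
  then have m0: "m (g1 \<cdot> L1) + m (g2 \<cdot> L2) = 0" by (simp add: cblinfun_add)
  have "1 \<le> Re (g1 x1) + Re (g2 x2)" using fx split(1)[of x1 x2] by (simp add: x_def g1 g2)
  also have "\<dots> = Re ((m (g1 \<cdot> L1) + g1 x1) + (m (g2 \<cdot> L2) + g2 x2))"
    using arg_cong[OF m0, of Re] by simp
  also have "\<dots> \<le> cmod (m (g1 \<cdot> L1) + g1 x1) + cmod (m (g2 \<cdot> L2) + g2 x2)"
    by (rule order_trans[OF complex_Re_le_cmod norm_triangle_ineq])
  also have "\<dots> \<le> s1 * norm g1 + s2 * norm g2" by (intro add_mono m1 m2)
  finally have le: "1 \<le> s1 * norm g1 + s2 * norm g2" .
  have "norm g1 \<noteq> 0 \<or> norm g2 \<noteq> 0" using le by force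
  then have "0 < (r1 - s1) * norm g1 + (r2 - s2) * norm g2"
    using s1 s2 by (auto intro: add_pos_nonneg add_nonneg_pos)
  then show False using le dual_norm by (simp add: algebra_simps)
qed

section \<open>Positive functionals and their semi-inner product\<close>

lemma quadratic_nonneg_imp_discriminant:
  fixes c d s :: real
  assumes nonneg: "\<And>t. 0 \<le> c - 2 * t * d + t\<^sup>2 * s" and s: "0 \<le> s"
  shows "d\<^sup>2 \<le> c * s"
proof (cases "s = 0")
  case True
  have "d = 0"
  proof (rule ccontr)
    assume "d \<noteq> 0"
    then show False using nonneg[of "(c + 1) / (2 * d)"] True by (simp add: field_simps)
  qed
  then show ?thesis using True by simp
next
  case False
  then have "0 < s" using s by simp
  have "c - 2 * (d / s) * d + (d / s)\<^sup>2 * s = c - d\<^sup>2 / s"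
    using False by (simp add: field_simps power2_eq_square)
  then have "d\<^sup>2 / s \<le> c" using nonneg[of "d / s"] by simp
  then show ?thesis using \<open>0 < s\<close> by (simp add: field_simps)
qed

definition positive_functional :: "('h::complex_hilbert_space) op dual \<Rightarrow> bool"
  where "positive_functional \<psi> \<longleftrightarrow>
    (\<forall>T. 0 \<le> Re (\<psi> (adj T \<cdot> T)) \<and> Im (\<psi> (adj T \<cdot> T)) = 0)"

text \<open>
  The seminorm of the semi-inner product \<open>\<psi> (S\<^sup>* T)\<close> that the Gelfand-Naimark-Segal construction
  completes to a Hilbert space.
\<close>
definition gns_norm :: "('h::complex_hilbert_space) op dual \<Rightarrow> 'h op \<Rightarrow> real"
  where "gns_norm \<psi> T = sqrt (Re (\<psi> (adj T \<cdot> T)))"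

lemma cinner_adj_comp_self: "cinner ((adj S \<cdot> S) \<xi>) \<xi> = complex_of_real ((norm (S \<xi>))\<^sup>2)"
  using cinner_adj[of "adj S" "S \<xi>" \<xi>] by (simp add: ccomp.rep_eq adj_adj cinner_self)

text \<open>
  The operator is \<open>T = (\<Sum>S\<leftarrow>Ss. cnj (\<phi> S) *\<^sub>C S)\<close>. The estimate is the Cauchy-Schwarz bound for
  \<open>T \<xi>\<close> in the additive form \<open>2 u v \<le> t u\<^sup>2 + v\<^sup>2 / t\<close>, which is preserved under adding a summand.
\<close>
lemma exists_functional_weighted_sum:
  fixes \<phi> :: "('h::complex_hilbert_space) op dual"
  shows "\<exists>T. \<phi> T = complex_of_real (\<Sum>S\<leftarrow>Ss. (cmod (\<phi> S))\<^sup>2) \<and>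
    (\<forall>\<xi> t. 0 < t \<longrightarrow> 2 * norm (T \<xi>) \<le> t * (\<Sum>S\<leftarrow>Ss. (cmod (\<phi> S))\<^sup>2) + (\<Sum>S\<leftarrow>Ss. (norm (cblinfun_apply S \<xi>))\<^sup>2) / t)"
proof (induction Ss)
  case Nil
  have "\<phi> 0 = 0" by (rule cblinfun_zero)
  then show ?case by (auto intro!: exI[of _ 0] simp: zero_cblinfun.rep_eq)
next
  case (Cons S Ss)
  then obtain T where T: "\<phi> T = complex_of_real (\<Sum>S\<leftarrow>Ss. (cmod (\<phi> S))\<^sup>2)"
    and T_le: "\<And>\<xi> t. 0 < t \<Longrightarrow>
      2 * norm (T \<xi>) \<le> t * (\<Sum>S\<leftarrow>Ss. (cmod (\<phi> S))\<^sup>2) + (\<Sum>S\<leftarrow>Ss. (norm (cblinfun_apply S \<xi>))\<^sup>2) / t"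
    by blast
  define V where "V = cnj (\<phi> S) *\<^sub>C S + T"
  have "\<phi> V = complex_of_real (\<Sum>S\<leftarrow>S # Ss. (cmod (\<phi> S))\<^sup>2)"
    using complex_norm_square[of "\<phi> S"]
    by (simp add: V_def cblinfun_add cblinfun_scaleC scaleC_complex_def T mult.commute)
  moreover have "2 * norm (V \<xi>) \<le> t * (\<Sum>S\<leftarrow>S # Ss. (cmod (\<phi> S))\<^sup>2) + (\<Sum>S\<leftarrow>S # Ss. (norm (cblinfun_apply S \<xi>))\<^sup>2) / t"
    if t: "0 < t" for \<xi> t
  proof -
    have "norm (V \<xi>) \<le> cmod (\<phi> S) * norm (S \<xi>) + norm (T \<xi>)"
      unfolding V_def plus_cblinfun.rep_eq scaleC_cblinfun.rep_eq
      by (rule order_trans[OF norm_triangle_ineq]) (simp add: norm_scaleC)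
    moreover have "2 * (cmod (\<phi> S) * norm (S \<xi>)) \<le> t * (cmod (\<phi> S))\<^sup>2 + (norm (S \<xi>))\<^sup>2 / t"
    proof -
      have "0 \<le> (t * cmod (\<phi> S) - norm (S \<xi>))\<^sup>2 / t" using t by simp
      also have "\<dots> = t * (cmod (\<phi> S))\<^sup>2 + (norm (S \<xi>))\<^sup>2 / t - 2 * (cmod (\<phi> S) * norm (S \<xi>))"
        using t by (simp add: power2_eq_square field_simps)
      finally show ?thesis by simp
    qed
    ultimately show ?thesis using T_le[OF t, of \<xi>] by (simp add: algebra_simps add_divide_distrib)
  qed
  ultimately show ?case by blast
qed

text \<open>
  In a representation with \<open>\<phi> T = \<langle>\<pi>(T) \<xi>, \<eta>\<rangle>\<close> and vectors \<open>\<xi>\<close>, \<open>\<eta>\<close> in the unit ball, one would take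
  \<open>\<psi> T = \<langle>\<pi>(T) \<xi>, \<xi>\<rangle>\<close>. Here \<open>\<psi>\<close> comes from Hahn-Banach: the demands are \<open>\<psi> a \<le> c\<close> whenever
  \<open>a \<le> c 1\<close> as quadratic forms, and \<open>\<psi> (S\<^sup>* S) \<ge> |\<phi> S|\<^sup>2\<close>. They are consistent because
  \<open>\<Sum> S\<^sup>* S \<le> c 1\<close> implies \<open>\<Sum> |\<phi> S|\<^sup>2 \<le> c\<close>: for \<open>w = \<Sum> |\<phi> S|\<^sup>2\<close>, the operator \<open>T\<close> of the
  preceding lemma has \<open>\<phi> T = w\<close> and \<open>|T| \<le> (w + c) / 2\<close>, so \<open>w \<le> (w + c) / 2\<close>.
\<close>
lemma functional_dominated_by_state:
  fixes \<phi> :: "('h::complex_hilbert_space) op dual"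
  assumes \<phi>: "norm \<phi> \<le> 1"
  shows "\<exists>\<psi>. positive_functional \<psi> \<and> (\<forall>T. cmod (\<psi> T) \<le> norm T) \<and> (\<forall>T. cmod (\<phi> T) \<le> gns_norm \<psi> T)"
proof -
  define w where "w Ss = (\<Sum>S\<leftarrow>Ss. (cmod (\<phi> S))\<^sup>2)" for Ss
  define n where "n Ss \<xi> = (\<Sum>S\<leftarrow>Ss. (norm (cblinfun_apply S \<xi>))\<^sup>2)" for Ss :: "'h op list" and \<xi>
  have w_append: "w (Ss @ Ts) = w Ss + w Ts" and n_append: "n (Ss @ Ts) \<xi> = n Ss \<xi> + n Ts \<xi>" for Ss Ts \<xi>
    by (simp_all add: w_def n_def)
  have w_scale: "w (map (\<lambda>S. complex_of_real (sqrt t) *\<^sub>C S) Ss) = t * w Ss"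
    and n_scale: "n (map (\<lambda>S. complex_of_real (sqrt t) *\<^sub>C S) Ss) \<xi> = t * n Ss \<xi>" if "0 \<le> t" for t Ss \<xi>
    using that by (induction Ss) (simp_all add: w_def n_def cblinfun_scaleC scaleC_cblinfun.rep_eq
        scaleC_complex_def norm_mult norm_scaleC power_mult_distrib algebra_simps)
  define q where "q a \<xi> = Re (cinner (cblinfun_apply a \<xi>) \<xi>)" for a :: "'h op" and \<xi>
  have q_add: "q (a + b) \<xi> = q a \<xi> + q b \<xi>" for a b \<xi>
    by (simp add: q_def plus_cblinfun.rep_eq cinner_add_left)
  have q_scale: "q (t *\<^sub>R a) \<xi> = t * q a \<xi>" for t a \<xi>
    by (simp add: q_def scaleC_of_real[symmetric] scaleC_cblinfun.rep_eq cinner_scaleC_left)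
  define K where "K = {(a, r). \<exists>c Ss. 0 \<le> c \<and> r = c - w Ss \<and> (\<forall>\<xi>. q a \<xi> + n Ss \<xi> \<le> c * (norm \<xi>)\<^sup>2)}"
  have norm_mem: "(a, norm a - w []) \<in> K" for a
  proof -
    have "q a \<xi> + n [] \<xi> \<le> norm a * (norm \<xi>)\<^sup>2" for \<xi>
    proof -
      have "q a \<xi> \<le> norm (a \<xi>) * norm \<xi>"
        unfolding q_def by (rule order_trans[OF complex_Re_le_cmod cmod_cinner_le])
      also have "\<dots> \<le> norm a * norm \<xi> * norm \<xi>" by (intro mult_right_mono norm_cblinfun norm_ge_zero)
      finally show ?thesis by (simp add: n_def power2_eq_square mult.assoc)
    qed
    then show ?thesis unfolding K_def by (auto intro!: exI[of _ "norm a"] exI[of _ "[]"])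
  qed
  have "\<exists>f. linear f \<and> (\<forall>a r. (a, r) \<in> K \<longrightarrow> f a \<le> r)"
  proof (rule hahn_banach_cone)
    fix u v assume "u \<in> K" "v \<in> K"
    then obtain a b c d Ss Ts where "u = (a, c - w Ss)" "v = (b, d - w Ts)" "0 \<le> c" "0 \<le> d"
      and le: "\<And>\<xi>. q a \<xi> + n Ss \<xi> \<le> c * (norm \<xi>)\<^sup>2" "\<And>\<xi>. q b \<xi> + n Ts \<xi> \<le> d * (norm \<xi>)\<^sup>2"
      unfolding K_def by blast
    moreover have "q (a + b) \<xi> + n (Ss @ Ts) \<xi> \<le> (c + d) * (norm \<xi>)\<^sup>2" for \<xi>
      using le(1)[of \<xi>] le(2)[of \<xi>] by (simp add: q_add n_append algebra_simps)
    ultimately show "u + v \<in> K" unfolding K_def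
      by (auto intro!: exI[of _ "c + d"] exI[of _ "Ss @ Ts"] simp: w_append)
  next
    fix t :: real and u assume t: "0 \<le> t" and "u \<in> K"
    then obtain a c Ss where "u = (a, c - w Ss)" "0 \<le> c"
      and le: "\<And>\<xi>. q a \<xi> + n Ss \<xi> \<le> c * (norm \<xi>)\<^sup>2"
      unfolding K_def by blast
    moreover have "q (t *\<^sub>R a) \<xi> + n (map (\<lambda>S. complex_of_real (sqrt t) *\<^sub>C S) Ss) \<xi> \<le> (t * c) * (norm \<xi>)\<^sup>2" for \<xi>
      using mult_left_mono[OF le[of \<xi>] t] t by (simp add: q_scale n_scale algebra_simps)
    ultimately show "t *\<^sub>R u \<in> K" unfolding K_def using t
      by (auto intro!: exI[of _ "t * c"] exI[of _ "map (\<lambda>S. complex_of_real (sqrt t) *\<^sub>C S) Ss"]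
          simp: w_scale algebra_simps)
  next
    fix r assume "(0, r) \<in> K"
    then obtain c Ss where r: "r = c - w Ss" and c: "0 \<le> c" and n_le: "\<And>\<xi>. n Ss \<xi> \<le> c * (norm \<xi>)\<^sup>2"
      unfolding K_def using q_scale[of 0 0] by auto
    have "\<exists>T. \<phi> T = complex_of_real (w Ss) \<and>
        (\<forall>\<xi> t. 0 < t \<longrightarrow> 2 * norm (T \<xi>) \<le> t * w Ss + n Ss \<xi> / t)"
      unfolding w_def n_def by (rule exists_functional_weighted_sum)
    then obtain T where T: "\<phi> T = complex_of_real (w Ss)"
      and T_le: "\<And>\<xi> t. 0 < t \<Longrightarrow> 2 * norm (T \<xi>) \<le> t * w Ss + n Ss \<xi> / t"
      by blast
    have w0: "0 \<le> w Ss" unfolding w_def by (rule sum_list_nonneg) auto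
    have "norm T \<le> (w Ss + c) / 2"
    proof (rule norm_cblinfun_bound)
      fix \<xi>
      show "norm (T \<xi>) \<le> (w Ss + c) / 2 * norm \<xi>"
      proof (cases "\<xi> = 0")
        case True
        then show ?thesis by (simp add: cblinfun_zero)
      next
        case False
        then have "n Ss \<xi> / norm \<xi> \<le> c * norm \<xi>"
          using n_le[of \<xi>] by (simp add: field_simps power2_eq_square)
        then show ?thesis using T_le[of "norm \<xi>" \<xi>] False by (simp add: algebra_simps)
      qed
    qed (use w0 c in simp)
    moreover have "cmod (\<phi> T) \<le> 1 * norm T"
      by (rule order_trans[OF norm_cblinfun]) (intro mult_right_mono \<phi> norm_ge_zero)
    ultimately show "0 \<le> r" using w0 by (simp add: T r)
  next
    show "\<exists>r. (a, r) \<in> K" for a using norm_mem ..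
  qed
  then obtain f where lin: "linear f" and fK: "\<And>a r. (a, r) \<in> K \<Longrightarrow> f a \<le> r" by blast
  have f_norm: "f a \<le> norm a" for a
    using fK[OF norm_mem] by (simp add: w_def)
  have f_le0: "f a \<le> 0" if "\<And>\<xi>. q a \<xi> \<le> 0" for a
    by (rule fK) (use that in \<open>auto simp: K_def w_def n_def intro!: exI[of _ 0] exI[of _ "[]"]\<close>)
  have q_neg: "q (- a) \<xi> = - q a \<xi>" for a \<xi> using q_scale[of "-1" a \<xi>] by simp
  have f_sq: "(cmod (\<phi> S))\<^sup>2 \<le> f (adj S \<cdot> S)" for S
  proof -
    have "f (- (adj S \<cdot> S)) \<le> - (cmod (\<phi> S))\<^sup>2"
    proof (rule fK)
      have "q (- (adj S \<cdot> S)) \<xi> + n [S] \<xi> \<le> 0 * (norm \<xi>)\<^sup>2" for \<xi>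
        by (simp only: q_neg) (simp only: q_def cinner_adj_comp_self, simp add: n_def)
      then show "(- (adj S \<cdot> S), - (cmod (\<phi> S))\<^sup>2) \<in> K"
        unfolding K_def by (auto intro!: exI[of _ 0] exI[of _ "[S]"] simp: w_def)
    qed
    then show ?thesis by (simp add: linear_neg[OF lin])
  qed
  \<comment> \<open>The demands only see the real part of the quadratic form of \<open>a\<close>, so \<open>f\<close> vanishes at
    skew-adjoint operators; this makes \<open>\<psi>\<close> real at \<open>S\<^sup>* S\<close>.\<close>
  have f_skew: "f (\<i> *\<^sub>C (adj S \<cdot> S)) = 0" for S
  proof -
    have "q (\<i> *\<^sub>C (adj S \<cdot> S)) \<xi> = 0" for \<xi>
      by (simp only: q_def scaleC_cblinfun.rep_eq cinner_scaleC_left cinner_adj_comp_self) simp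
    then have "f (\<i> *\<^sub>C (adj S \<cdot> S)) \<le> 0" "f (- (\<i> *\<^sub>C (adj S \<cdot> S))) \<le> 0"
      by (auto intro!: f_le0 simp: q_neg)
    then show ?thesis by (simp add: linear_neg[OF lin])
  qed
  have "f a \<le> 1 * norm a" for a using f_norm by simp
  from real_linear_complexify[OF lin this] obtain \<psi> :: "'h op dual"
    where \<psi>: "\<And>a. \<psi> a = Complex (f a) (- f (\<i> *\<^sub>C a))" by blast
  have "cmod (\<psi> T) \<le> norm T" for T
  proof -
    obtain u where u: "cmod u = 1" "u * \<psi> T = cmod (\<psi> T)" using complex_rotate by blast
    have "cmod (\<psi> T) = Re (\<psi> (u *\<^sub>C T))" using u by (simp add: cblinfun_scaleC scaleC_complex_def)
    also have "\<dots> \<le> norm (u *\<^sub>C T)" using f_norm by (simp add: \<psi>)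
    finally show ?thesis using u by (simp add: norm_scaleC)
  qed
  moreover have "positive_functional \<psi>"
    using f_sq f_skew by (force simp: positive_functional_def \<psi> intro: order_trans[OF zero_le_power2])
  moreover have "cmod (\<phi> T) \<le> gns_norm \<psi> T" for T
    using f_sq[of T] by (auto simp: gns_norm_def \<psi> intro: real_le_rsqrt)
  ultimately show ?thesis by blast
qed

lemma functional_adj_comp_add:
  fixes \<psi> :: "('h::complex_hilbert_space) op dual"
  shows "\<psi> (adj (S + T) \<cdot> (S + T)) = \<psi> (adj S \<cdot> S) + \<psi> (adj S \<cdot> T) + \<psi> (adj T \<cdot> S) + \<psi> (adj T \<cdot> T)"
  by (simp add: adj_add ccomp_add_left ccomp_add_right cblinfun_add)

lemma positive_functional_hermitian:
  assumes "positive_functional \<psi>"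
  shows "\<psi> (adj T \<cdot> S) = cnj (\<psi> (adj S \<cdot> T))"
proof -
  have Im: "Im (\<psi> (adj V \<cdot> V)) = 0" for V using assms by (simp add: positive_functional_def)
  have "Im (\<psi> (adj S \<cdot> T)) + Im (\<psi> (adj T \<cdot> S)) = 0"
    using functional_adj_comp_add[of \<psi> S T, THEN arg_cong[where f=Im]] by (simp add: Im)
  moreover have "Re (\<psi> (adj S \<cdot> T)) - Re (\<psi> (adj T \<cdot> S)) = 0"
    using functional_adj_comp_add[of \<psi> S "\<i> *\<^sub>C T", THEN arg_cong[where f=Im]]
    by (simp only: Im plus_complex.sel)
      (simp add: adj_scaleC ccomp_scaleC_left ccomp_scaleC_right cblinfun_scaleC scaleC_complex_def)
  ultimately show ?thesis by (simp add: complex_eq_iff)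
qed

lemma gns_norm_nonneg: "positive_functional \<psi> \<Longrightarrow> 0 \<le> gns_norm \<psi> T"
  by (simp add: gns_norm_def positive_functional_def)

lemma gns_norm_square:
  assumes "positive_functional \<psi>"
  shows "\<psi> (adj T \<cdot> T) = complex_of_real ((gns_norm \<psi> T)\<^sup>2)"
  using assms by (simp add: gns_norm_def positive_functional_def complex_eq_iff)

lemma gns_norm_add_scale:
  assumes \<psi>: "positive_functional \<psi>"
  shows "(gns_norm \<psi> (S + c *\<^sub>C T))\<^sup>2 =
    (gns_norm \<psi> S)\<^sup>2 + 2 * Re (c * \<psi> (adj S \<cdot> T)) + (cmod c)\<^sup>2 * (gns_norm \<psi> T)\<^sup>2"
proof -
  have sq: "(gns_norm \<psi> V)\<^sup>2 = Re (\<psi> (adj V \<cdot> V))" for V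
    by (simp add: gns_norm_square[OF \<psi>])
  have "c * cnj c = complex_of_real ((cmod c)\<^sup>2)"
    using complex_norm_square[of c] by simp
  then have "\<psi> (adj (c *\<^sub>C T) \<cdot> (c *\<^sub>C T)) = complex_of_real ((cmod c)\<^sup>2) * \<psi> (adj T \<cdot> T)"
    by (simp add: adj_scaleC ccomp_scaleC_left ccomp_scaleC_right cblinfun_scaleC scaleC_complex_def
        mult.assoc[symmetric])
  moreover have "\<psi> (adj (c *\<^sub>C T) \<cdot> S) = cnj (c * \<psi> (adj S \<cdot> T))"
    using positive_functional_hermitian[OF \<psi>, of T S]
    by (simp add: adj_scaleC ccomp_scaleC_left cblinfun_scaleC scaleC_complex_def)
  moreover have "\<psi> (adj S \<cdot> (c *\<^sub>C T)) = c * \<psi> (adj S \<cdot> T)"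
    by (simp add: ccomp_scaleC_right cblinfun_scaleC scaleC_complex_def)
  ultimately show ?thesis
    unfolding sq functional_adj_comp_add by (simp only: plus_complex.sel) simp
qed

lemma gns_cauchy_schwarz:
  assumes \<psi>: "positive_functional \<psi>"
  shows "cmod (\<psi> (adj S \<cdot> T)) \<le> gns_norm \<psi> S * gns_norm \<psi> T"
proof -
  obtain u where u: "cmod u = 1" "u * \<psi> (adj S \<cdot> T) = cmod (\<psi> (adj S \<cdot> T))"
    using complex_rotate by blast
  have "(cmod (\<psi> (adj S \<cdot> T)))\<^sup>2 \<le> (gns_norm \<psi> S)\<^sup>2 * (gns_norm \<psi> T)\<^sup>2"
  proof (rule quadratic_nonneg_imp_discriminant)
    fix t :: real
    define c where "c = complex_of_real (- t) * u"
    have "c * \<psi> (adj S \<cdot> T) = complex_of_real (- t * cmod (\<psi> (adj S \<cdot> T)))"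
      using u(2) by (simp add: c_def mult.assoc)
    moreover have "(cmod c)\<^sup>2 = t\<^sup>2" using u by (simp add: c_def norm_mult)
    ultimately show "0 \<le> (gns_norm \<psi> S)\<^sup>2 - 2 * t * cmod (\<psi> (adj S \<cdot> T)) + t\<^sup>2 * (gns_norm \<psi> T)\<^sup>2"
      using gns_norm_add_scale[OF \<psi>, of S c T] zero_le_power2[of "gns_norm \<psi> (S + c *\<^sub>C T)"]
      by simp
  qed simp
  then have "(cmod (\<psi> (adj S \<cdot> T)))\<^sup>2 \<le> (gns_norm \<psi> S * gns_norm \<psi> T)\<^sup>2"
    by (simp add: power_mult_distrib)
  then show ?thesis by (rule power2_le_imp_le) (simp add: gns_norm_nonneg[OF \<psi>])
qed

text \<open>
  Without completeness a functional that is bounded for the seminorm need not be an inner product with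
  some \<open>S\<close>, but an almost minimizer \<open>S\<close> of \<open>|S|\<^sup>2 - 2 Re (g S)\<close> represents it up to a small multiple
  of the seminorm, uniformly in \<open>T\<close>.
\<close>
lemma gns_approximate_riesz:
  assumes \<psi>: "positive_functional \<psi>" and g: "\<And>T. cmod (cblinfun_apply g T) \<le> M * gns_norm \<psi> T"
    and e: "0 < e"
  shows "\<exists>S. \<forall>T. cmod (g T - \<psi> (adj S \<cdot> T)) \<le> e * gns_norm \<psi> T"
proof -
  define F where "F S = (gns_norm \<psi> S)\<^sup>2 - 2 * Re (g S)" for S
  have F_ge: "- M\<^sup>2 \<le> F S" for S
  proof -
    have "Re (g S) \<le> M * gns_norm \<psi> S" using g complex_Re_le_cmod order_trans by blast
    moreover have "0 \<le> (gns_norm \<psi> S - M)\<^sup>2" by simp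
    ultimately show ?thesis by (simp add: F_def power2_diff mult.commute)
  qed
  then have bdd: "bdd_below (range F)" by (intro bdd_belowI[of _ "- M\<^sup>2"]) auto
  have "Inf (range F) < Inf (range F) + e\<^sup>2" using e by simp
  then obtain S where S: "F S < Inf (range F) + e\<^sup>2"
    using cInf_lessD[of "range F"] by (metis UNIV_not_empty empty_is_image rangeE)
  have "cmod (g T - \<psi> (adj S \<cdot> T)) \<le> e * gns_norm \<psi> T" for T
  proof -
    define z where "z = g T - \<psi> (adj S \<cdot> T)"
    obtain u where u: "cmod u = 1" "u * z = cmod z" using complex_rotate by blast
    have "(cmod z)\<^sup>2 \<le> e\<^sup>2 * (gns_norm \<psi> T)\<^sup>2"
    proof (rule quadratic_nonneg_imp_discriminant)
      fix t :: real
      define c where "c = complex_of_real t * u"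
      have "Inf (range F) \<le> F (S + c *\<^sub>C T)" by (intro cInf_lower bdd) simp
      then have "F S - e\<^sup>2 \<le> F (S + c *\<^sub>C T)" using S by simp
      also have "\<dots> = F S - 2 * Re (c * z) + (cmod c)\<^sup>2 * (gns_norm \<psi> T)\<^sup>2"
        by (simp add: F_def gns_norm_add_scale[OF \<psi>] z_def cblinfun_add cblinfun_scaleC
            scaleC_complex_def algebra_simps)
      also have "c * z = complex_of_real (t * cmod z)" using u(2) by (simp add: c_def mult.assoc)
      also have "(cmod c)\<^sup>2 = t\<^sup>2" using u by (simp add: c_def norm_mult)
      finally show "0 \<le> e\<^sup>2 - 2 * t * cmod z + t\<^sup>2 * (gns_norm \<psi> T)\<^sup>2" by simp
    qed simp
    then have "(cmod z)\<^sup>2 \<le> (e * gns_norm \<psi> T)\<^sup>2" by (simp add: power_mult_distrib)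
    then show ?thesis unfolding z_def[symmetric]
      by (rule power2_le_imp_le) (use e gns_norm_nonneg[OF \<psi>] in simp)
  qed
  then show ?thesis by blast
qed

section \<open>The Arens product and the involution\<close>

lemma norm_arens: "norm (m \<odot> n) \<le> norm m * norm n"
proof (rule norm_cblinfun_bound)
  fix \<phi>
  have "norm (m (bidual_act n \<phi>)) \<le> norm m * norm (bidual_act n \<phi>)" by (rule norm_cblinfun)
  also have "\<dots> \<le> norm m * (norm n * norm \<phi>)" by (intro mult_left_mono norm_bidual_act norm_ge_zero)
  finally show "norm ((m \<odot> n) \<phi>) \<le> norm m * norm n * norm \<phi>" by (simp add: arens.rep_eq mult.assoc)
qed simp

lemma bidual_act_add: "bidual_act (m + n) \<phi> = bidual_act m \<phi> + bidual_act n \<phi>"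
  by (rule cblinfun_eqI) (simp add: bidual_act.rep_eq plus_cblinfun.rep_eq)

lemma bidual_act_diff: "bidual_act (m - n) \<phi> = bidual_act m \<phi> - bidual_act n \<phi>"
  by (rule cblinfun_eqI) (simp add: bidual_act.rep_eq minus_cblinfun.rep_eq)

lemma bidual_act_scaleC: "bidual_act (c *\<^sub>C m) \<phi> = c *\<^sub>C bidual_act m \<phi>"
  by (rule cblinfun_eqI) (simp add: bidual_act.rep_eq scaleC_cblinfun.rep_eq)

lemma arens_add: "(m + n) \<odot> k = m \<odot> k + n \<odot> k" "k \<odot> (m + n) = k \<odot> m + k \<odot> n"
  by (rule cblinfun_eqI, simp add: arens.rep_eq plus_cblinfun.rep_eq bidual_act_add cblinfun_add)+

lemma arens_diff: "(m - n) \<odot> k = m \<odot> k - n \<odot> k" "k \<odot> (m - n) = k \<odot> m - k \<odot> n"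
  by (rule cblinfun_eqI, simp add: arens.rep_eq minus_cblinfun.rep_eq bidual_act_diff cblinfun_diff)+

lemma arens_scaleC: "(c *\<^sub>C m) \<odot> n = c *\<^sub>C (m \<odot> n)" "m \<odot> (c *\<^sub>C n) = c *\<^sub>C (m \<odot> n)"
  by (rule cblinfun_eqI, simp add: arens.rep_eq scaleC_cblinfun.rep_eq bidual_act_scaleC cblinfun_scaleC)+

lemma arens_assoc: "m \<odot> n \<odot> k = m \<odot> (n \<odot> k)"
proof -
  have "dual_act (dual_act \<phi> S) T = dual_act \<phi> (S \<cdot> T)" for \<phi> :: "'a op dual" and S T
    by (rule cblinfun_eqI) (simp add: dual_act.rep_eq ccomp_assoc)
  then have "dual_act (bidual_act k \<phi>) S = bidual_act k (dual_act \<phi> S)" for \<phi> S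
    by (intro cblinfun_eqI) (simp add: dual_act.rep_eq bidual_act.rep_eq)
  then have "bidual_act n (bidual_act k \<phi>) = bidual_act (n \<odot> k) \<phi>" for \<phi>
    by (intro cblinfun_eqI) (simp add: arens.rep_eq bidual_act.rep_eq)
  then show ?thesis by (intro cblinfun_eqI) (simp add: arens.rep_eq)
qed

lemma arens_unit [simp]: "to_bidual cid \<odot> m = m" "m \<odot> to_bidual cid = m"
  by (rule cblinfun_eqI, simp add: arens.rep_eq to_bidual.rep_eq bidual_act.rep_eq,
      intro arg_cong[where f="cblinfun_apply m"] cblinfun_eqI,
      simp add: dual_act.rep_eq bidual_act.rep_eq to_bidual.rep_eq)+

lemma to_bidual_add: "to_bidual (S + T) = to_bidual S + to_bidual T"
  by (rule cblinfun_eqI) (simp add: to_bidual.rep_eq plus_cblinfun.rep_eq cblinfun_add)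

lemma to_bidual_diff: "to_bidual (S - T) = to_bidual S - to_bidual T"
  by (rule cblinfun_eqI) (simp add: to_bidual.rep_eq minus_cblinfun.rep_eq cblinfun_diff)

lemma to_bidual_scaleC: "to_bidual (c *\<^sub>C T) = c *\<^sub>C to_bidual T"
  by (rule cblinfun_eqI) (simp add: to_bidual.rep_eq scaleC_cblinfun.rep_eq cblinfun_scaleC)

lemma to_bidual_zero [simp]: "to_bidual 0 = 0"
  using to_bidual_diff[of 0 0] by simp

lemma arens_zero [simp]: "0 \<odot> m = 0" "m \<odot> 0 = 0"
  using arens_diff(1)[of 0 0 m] arens_diff(2)[of m 0 0] by simp_all

lemma norm_to_bidual_le: "norm (to_bidual T) \<le> norm T"
  by (rule norm_cblinfun_bound) (simp_all add: to_bidual.rep_eq norm_cblinfun mult.commute[of "norm T"])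

lemma bidual_star_diff: "bidual_star (m - n) = bidual_star m - bidual_star n"
  by (rule cblinfun_eqI) (simp add: bidual_star.rep_eq minus_cblinfun.rep_eq)

lemma bidual_star_scaleC: "bidual_star (c *\<^sub>C m) = cnj c *\<^sub>C bidual_star m"
  by (rule cblinfun_eqI) (simp add: bidual_star.rep_eq scaleC_cblinfun.rep_eq scaleC_complex_def)

lemma norm_dual_star_le: "norm (dual_star \<phi>) \<le> norm \<phi>"
proof (rule norm_cblinfun_bound)
  fix T
  have "norm (\<phi> (adj T)) \<le> norm \<phi> * norm (adj T)" by (rule norm_cblinfun)
  also have "\<dots> \<le> norm \<phi> * norm T" by (intro mult_left_mono norm_adj_le norm_ge_zero)
  finally show "norm (dual_star \<phi> T) \<le> norm \<phi> * norm T" by (simp add: dual_star.rep_eq)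
qed simp

lemma norm_bidual_star_le: "norm (bidual_star m) \<le> norm m"
proof (rule norm_cblinfun_bound)
  fix \<phi>
  have "norm (m (dual_star \<phi>)) \<le> norm m * norm (dual_star \<phi>)" by (rule norm_cblinfun)
  also have "\<dots> \<le> norm m * norm \<phi>" by (intro mult_left_mono norm_dual_star_le norm_ge_zero)
  finally show "norm (bidual_star m \<phi>) \<le> norm m * norm \<phi>" by (simp add: bidual_star.rep_eq)
qed simp

text \<open>
  With one factor in \<open>B(H)\<close>, the involution reverses products by direct computation; for general
  factors this would amount to the Arens regularity of \<open>B(H)\<close>.
\<close>
lemma bidual_star_arens_to_bidual:
  "bidual_star (to_bidual T \<odot> m) = bidual_star m \<odot> to_bidual (adj T)"
  "bidual_star (m \<odot> to_bidual T) = to_bidual (adj T) \<odot> bidual_star m"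
proof -
  have "dual_act (dual_star \<phi>) T = dual_star (bidual_act (to_bidual (adj T)) \<phi>)" for \<phi>
    by (rule cblinfun_eqI)
      (simp add: dual_act.rep_eq dual_star.rep_eq bidual_act.rep_eq to_bidual.rep_eq adj_ccomp)
  then show "bidual_star (to_bidual T \<odot> m) = bidual_star m \<odot> to_bidual (adj T)"
    by (intro cblinfun_eqI) (simp add: bidual_star.rep_eq arens.rep_eq to_bidual.rep_eq bidual_act.rep_eq)
  have "bidual_act (to_bidual T) (dual_star \<phi>) = dual_star (dual_act \<phi> (adj T))" for \<phi>
    by (rule cblinfun_eqI)
      (simp add: dual_act.rep_eq dual_star.rep_eq bidual_act.rep_eq to_bidual.rep_eq adj_ccomp)
  then show "bidual_star (m \<odot> to_bidual T) = to_bidual (adj T) \<odot> bidual_star m"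
    by (intro cblinfun_eqI) (simp add: bidual_star.rep_eq arens.rep_eq to_bidual.rep_eq bidual_act.rep_eq)
qed

section \<open>The C*-inequality in the bidual\<close>

text \<open>
  In the Hilbert space of \<open>\<psi>\<close>, with cyclic vector \<open>\<xi>\<close>, one has \<open>\<phi> T = \<langle>T \<xi>, \<eta>\<rangle>\<close> with \<open>|\<eta>| \<le> 1\<close>, so that
  \<open>|m \<phi>| = |\<langle>m \<xi>, \<eta>\<rangle>| \<le> |m \<xi>|\<close> and \<open>|m \<xi>|\<^sup>2 = (m\<^sup>* m) \<psi>\<close>. The proof replaces \<open>\<eta>\<close> by \<open>S \<xi>\<close> and \<open>m \<xi>\<close> by \<open>R \<xi>\<close> for
  operators \<open>S\<close> and \<open>R\<close>, up to an error \<open>e\<close> that is uniform on the unit ball of the seminorm; the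
  bounded functional \<open>m\<close> respects such errors.
\<close>
lemma bidual_dominated_by_state:
  assumes \<psi>: "positive_functional \<psi>" and contr: "\<And>T. cmod (cblinfun_apply \<psi> T) \<le> norm T"
    and \<phi>: "\<And>T. cmod (cblinfun_apply \<phi> T) \<le> gns_norm \<psi> T"
  shows "(cmod (cblinfun_apply m \<phi>))\<^sup>2 \<le> cmod ((bidual_star m \<odot> m) \<psi>)"
proof -
  define B where "B S T = \<psi> (adj S \<cdot> T)" for S T
  define s where "s = gns_norm \<psi>"
  define M where "M = norm m"
  have s0: "0 \<le> s T" for T unfolding s_def by (rule gns_norm_nonneg[OF \<psi>])
  have s_norm: "s T \<le> norm T" for T
  proof -
    have "(s T)\<^sup>2 = cmod (\<psi> (adj T \<cdot> T))" by (simp add: s_def gns_norm_square[OF \<psi>] norm_power)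
    also have "\<dots> \<le> norm (adj T \<cdot> T)" by (rule contr)
    also have "\<dots> \<le> norm (adj T) * norm T" by (rule norm_ccomp)
    also have "\<dots> \<le> (norm T)\<^sup>2" unfolding power2_eq_square by (intro mult_right_mono norm_adj_le norm_ge_zero)
    finally show ?thesis by (rule power2_le_imp_le) simp
  qed
  \<comment> \<open>\<open>m\<close> is bounded by \<open>M\<close> also on functionals that are bounded in the seminorm \<open>s\<close>.\<close>
  have m_le: "cmod (m f) \<le> M * d" if "\<And>T. cmod (cblinfun_apply f T) \<le> d * s T" "0 \<le> d" for f d
  proof -
    have "norm f \<le> d"
      by (rule norm_cblinfun_bound[OF that(2)])
        (rule order_trans[OF that(1)], intro mult_left_mono s_norm that(2))
    then have "M * norm f \<le> M * d" by (simp add: M_def mult_left_mono)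
    then show ?thesis using norm_cblinfun[of m f] by (simp add: M_def)
  qed
  have BS: "dual_act \<psi> (adj S) T = B S T" for S T by (simp add: B_def dual_act.rep_eq)
  \<comment> \<open>\<open>h S\<close> stands for \<open>\<langle>m \<xi>, S \<xi>\<rangle>\<close> and \<open>g\<close> for the functional \<open>S \<mapsto> \<langle>S \<xi>, m \<xi>\<rangle>\<close>.\<close>
  define h where "h S = m (dual_act \<psi> (adj S))" for S
  define g where "g = dual_star (bidual_act m \<psi>)"
  have g: "g S = cnj (h S)" for S by (simp add: g_def h_def dual_star.rep_eq bidual_act.rep_eq)
  define \<kappa> where "\<kappa> = (bidual_star m \<odot> m) \<psi>"
  have \<kappa>: "\<kappa> = cnj (m g)" by (simp add: \<kappa>_def g_def arens.rep_eq bidual_star.rep_eq)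
  have cs: "cmod (B S T) \<le> s S * s T" for S T
    unfolding B_def s_def by (rule gns_cauchy_schwarz[OF \<psi>])
  have g_le: "cmod (g S) \<le> M * s S" for S
    unfolding g using m_le[of "dual_act \<psi> (adj S)" "s S"] cs s0 by (simp add: BS h_def)
  have B_self: "B S S = complex_of_real ((s S)\<^sup>2)" for S
    by (simp add: B_def s_def gns_norm_square[OF \<psi>])
  have M0: "0 \<le> M" by (simp add: M_def)
  have bound: "cmod (m \<phi>) \<le> M * e + (e * (1 + e) + (1 + e) * sqrt (cmod \<kappa> + (M * e + e * (M + e))))"
    if e: "0 < e" for e
  proof -
    obtain S where S: "\<And>T. cmod (\<phi> T - B S T) \<le> e * s T"
      using gns_approximate_riesz[OF \<psi> _ e, of \<phi> 1] \<phi> unfolding B_def s_def by auto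
    obtain R where R: "\<And>T. cmod (g T - B R T) \<le> e * s T"
      using gns_approximate_riesz[OF \<psi> g_le[unfolded s_def] e] unfolding B_def s_def by auto
    \<comment> \<open>An approximate representing vector is not much longer than the functional.\<close>
    have len: "s V \<le> C + e"
      if "\<And>T. cmod (cblinfun_apply f T - B V T) \<le> e * s T"
        "\<And>T. cmod (cblinfun_apply f T) \<le> C * s T" "0 \<le> C" for f V C
    proof (cases "s V = 0")
      case False
      have "(s V)\<^sup>2 = cmod (B V V)" by (simp add: B_self norm_power)
      also have "\<dots> \<le> cmod (f V - B V V) + cmod (f V)"
        by (metis add.commute diff_add_cancel norm_minus_commute norm_triangle_ineq)
      also have "\<dots> \<le> (C + e) * s V" using that(1)[of V] that(2)[of V] by (simp add: algebra_simps)
      finally show ?thesis using False s0[of V] by (simp add: power2_eq_square)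
    qed (use that e in simp)
    have sS: "s S \<le> 1 + e" by (rule len[of \<phi>]) (use S \<phi> in \<open>simp_all add: s_def\<close>)
    have sR: "s R \<le> M + e" by (rule len[of g]) (use R g_le M0 in simp_all)
    have 1: "cmod (m \<phi> - h S) \<le> M * e"
      using m_le[of "\<phi> - dual_act \<psi> (adj S)" e] S e
      by (simp add: h_def cblinfun_diff minus_cblinfun.rep_eq BS)
    have 2: "cmod (m g - h R) \<le> M * e"
      using m_le[of "g - dual_act \<psi> (adj R)" e] R e
      by (simp add: h_def cblinfun_diff minus_cblinfun.rep_eq BS)
    have cnj_g: "cmod (h T - cnj (B R T)) \<le> e * s T" for T
      using R[of T] unfolding g by (metis complex_cnj_cnj complex_cnj_diff complex_mod_cnj)
    have "cmod (h S) \<le> cmod (h S - cnj (B R S)) + cmod (B R S)"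
      using norm_triangle_ineq[of "h S - cnj (B R S)" "cnj (B R S)"] by simp
    also have "\<dots> \<le> e * s S + s R * s S" using cnj_g[of S] cs[of R S] by simp
    also have "\<dots> \<le> e * (1 + e) + s R * (1 + e)"
      using sS e s0 by (intro add_mono mult_left_mono) auto
    also have "\<dots> = e * (1 + e) + (1 + e) * s R" by simp
    finally have 3: "cmod (h S) \<le> e * (1 + e) + (1 + e) * s R" .
    have "cmod (m g - complex_of_real ((s R)\<^sup>2)) \<le> M * e + e * s R"
      using norm_triangle_ineq[of "m g - h R" "h R - complex_of_real ((s R)\<^sup>2)"] 2 cnj_g[of R]
      by (simp add: B_self)
    moreover have "(s R)\<^sup>2 \<le> cmod (m g) + cmod (m g - complex_of_real ((s R)\<^sup>2))"
      using norm_triangle_ineq4[of "m g" "m g - complex_of_real ((s R)\<^sup>2)"] by (simp add: norm_power)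
    moreover have "e * s R \<le> e * (M + e)" using sR e by simp
    ultimately have "(s R)\<^sup>2 \<le> cmod \<kappa> + (M * e + e * (M + e))" by (simp add: \<kappa>)
    then have "s R \<le> sqrt (cmod \<kappa> + (M * e + e * (M + e)))" by (rule real_le_rsqrt)
    then have "(1 + e) * s R \<le> (1 + e) * sqrt (cmod \<kappa> + (M * e + e * (M + e)))"
      using e by (intro mult_left_mono) auto
    then show ?thesis
      using 1 3 norm_triangle_ineq[of "m \<phi> - h S" "h S"] by simp
  qed
  have "((\<lambda>e. M * e + (e * (1 + e) + (1 + e) * sqrt (cmod \<kappa> + (M * e + e * (M + e)))))
      \<longlongrightarrow> M * 0 + (0 * (1 + 0) + (1 + 0) * sqrt (cmod \<kappa> + (M * 0 + 0 * (M + 0))))) (at_right 0)"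
    by (intro tendsto_intros)
  moreover have "\<forall>\<^sub>F e in at_right 0. cmod (m \<phi>) \<le>
      M * e + (e * (1 + e) + (1 + e) * sqrt (cmod \<kappa> + (M * e + e * (M + e))))"
    using bound by (intro eventually_at_right_less[THEN eventually_mono]) blast
  ultimately have "cmod (m \<phi>) \<le> sqrt (cmod \<kappa>)"
    using tendsto_lowerbound[OF _ _ trivial_limit_at_right_real] by fastforce
  then have "(cmod (m \<phi>))\<^sup>2 \<le> (sqrt (cmod \<kappa>))\<^sup>2" by (rule power_mono) simp
  then show ?thesis by (simp add: \<kappa>_def)
qed

theorem bidual_cstar_inequality: "(norm m)\<^sup>2 \<le> norm (bidual_star m \<odot> m)"
proof -
  define k where "k = norm (bidual_star m \<odot> m)"
  have "1 * norm m \<le> sqrt k"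
  proof (rule norm_cblinfun_bound_ball)
    fix \<phi> :: "'a op dual" assume "norm \<phi> \<le> 1"
    then obtain \<psi> where \<psi>: "positive_functional \<psi>" "\<And>T. cmod (\<psi> T) \<le> norm T"
      and le: "\<And>T. cmod (\<phi> T) \<le> gns_norm \<psi> T"
      using functional_dominated_by_state by blast
    have "norm \<psi> \<le> 1" by (rule norm_cblinfun_bound) (use \<psi> in auto)
    then have "k * norm \<psi> \<le> k" by (simp add: k_def mult_left_le)
    then have "(cmod (m \<phi>))\<^sup>2 \<le> k"
      using bidual_dominated_by_state[OF \<psi> le, of m] norm_cblinfun[of "bidual_star m \<odot> m" \<psi>]
      by (simp add: k_def)
    then show "cmod (m \<phi>) \<le> sqrt k" by (rule real_le_rsqrt)
  qed simp
  then have "(norm m)\<^sup>2 \<le> (sqrt k)\<^sup>2" by (intro power_mono) auto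
  then show ?thesis by (simp add: k_def)
qed

section \<open>Projections in the bidual\<close>

lemma norm_projection_le:
  assumes "projection p"
  shows "norm p \<le> 1"
proof -
  have "norm p * norm p \<le> norm p * 1"
    using bidual_cstar_inequality[of p] assms by (simp add: projection_def power2_eq_square)
  then show ?thesis by (cases "norm p = 0") simp_all
qed

text \<open>
  The norm of a sum with orthogonal ranges and supports is the maximum of the two norms, in the one case
  that is needed: \<open>x (1 - p) + t x p\<close> with \<open>x\<close> commuting with \<open>p\<close>. It equals \<open>x k\<close> with
  \<open>k = (1 - p) + t p\<close>, and the passage from \<open>x k\<close> to \<open>(x k)\<^sup>* (x k) = (x\<^sup>* x) k\<^sup>2\<close> squares both parts
  separately, so the C*-inequality can be iterated.
\<close>
lemma norm_projection_combination_le: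
  assumes p: "projection p" and comm: "to_bidual x \<odot> p = p \<odot> to_bidual x"
    and out: "norm (to_bidual x \<odot> (to_bidual cid - p)) \<le> 1"
    and ins: "norm (complex_of_real t *\<^sub>C (to_bidual x \<odot> p)) \<le> 1"
  shows "norm (to_bidual x \<odot> (to_bidual cid - p) + complex_of_real t *\<^sub>C (to_bidual x \<odot> p)) \<le> 1"
proof -
  have pp: "p \<odot> p = p" and p_star: "bidual_star p = p" using p by (auto simp: projection_def)
  define k where "k s = (to_bidual cid - p) + complex_of_real s *\<^sub>C p" for s
  have k_star: "bidual_star (k s) = k s" for s
  proof -
    have "k s = to_bidual cid - complex_of_real (1 - s) *\<^sub>C p"
      using scaleC_add_left[of "complex_of_real (1 - s)" "complex_of_real s" p]
      by (simp add: k_def algebra_simps)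
    moreover have "adj cid = (cid :: 'a op)" by (rule adj_unique) (simp add: cid.rep_eq)
    ultimately show ?thesis
      by (simp add: bidual_star_diff bidual_star_scaleC p_star bidual_star_to_bidual)
  qed
  have k_sq: "k s \<odot> k s = k (s\<^sup>2)" for s
    by (simp add: k_def arens_add arens_diff arens_scaleC pp scaleC_scaleC power2_eq_square)
  have adj_comm: "to_bidual (adj y) \<odot> p = p \<odot> to_bidual (adj y)"
    if "to_bidual y \<odot> p = p \<odot> to_bidual y" for y
    using arg_cong[OF that, of bidual_star] by (simp add: bidual_star_arens_to_bidual p_star)
  have comm_sq: "to_bidual (adj y \<cdot> y) \<odot> p = p \<odot> to_bidual (adj y \<cdot> y)"
    if "to_bidual y \<odot> p = p \<odot> to_bidual y" for y
    using that adj_comm[OF that] by (metis arens_assoc arens_to_bidual)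
  have square: "bidual_star (to_bidual y \<odot> k s) \<odot> (to_bidual y \<odot> k s) = to_bidual (adj y \<cdot> y) \<odot> k (s\<^sup>2)"
    if y: "to_bidual y \<odot> p = p \<odot> to_bidual y" for y s
  proof -
    define z where "z = to_bidual (adj y \<cdot> y)"
    have "bidual_star (to_bidual y \<odot> k s) \<odot> (to_bidual y \<odot> k s) = k s \<odot> z \<odot> k s"
      by (simp add: bidual_star_arens_to_bidual k_star z_def arens_to_bidual[symmetric] arens_assoc)
    also have "k s \<odot> z = z \<odot> k s"
      using comm_sq[OF y] by (simp add: k_def z_def arens_add arens_diff arens_scaleC)
    finally show ?thesis by (simp add: arens_assoc k_sq z_def)
  qed
  have square_p: "bidual_star (c *\<^sub>C (to_bidual y \<odot> p)) \<odot> (c *\<^sub>C (to_bidual y \<odot> p))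
      = (cnj c * c) *\<^sub>C (to_bidual (adj y \<cdot> y) \<odot> p)"
    if y: "to_bidual y \<odot> p = p \<odot> to_bidual y" for y c
  proof -
    define z where "z = to_bidual (adj y \<cdot> y)"
    have "bidual_star (to_bidual y \<odot> p) \<odot> (to_bidual y \<odot> p) = p \<odot> z \<odot> p"
      by (simp add: bidual_star_arens_to_bidual p_star z_def arens_to_bidual[symmetric] arens_assoc)
    also have "\<dots> = z \<odot> p" using comm_sq[OF y, symmetric] by (simp add: z_def[symmetric] arens_assoc pp)
    finally show ?thesis by (simp add: bidual_star_scaleC arens_scaleC scaleC_scaleC z_def mult.commute)
  qed
  have star_le: "norm (bidual_star m \<odot> m) \<le> 1" if "norm m \<le> 1" for m :: "'a op_bidual"
  proof -
    have "norm (bidual_star m \<odot> m) \<le> norm (bidual_star m) * norm m" by (rule norm_arens)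
    also have "\<dots> \<le> 1 * 1" by (intro mult_mono order_trans[OF norm_bidual_star_le] that) simp_all
    finally show ?thesis by simp
  qed
  have k0: "k 0 = to_bidual cid - p"
    using scaleC_of_real[of 0 p] by (simp add: k_def)
  \<comment> \<open>The triangle inequality gives the bound \<open>2\<close>; it improves to \<open>1\<close> because the hypotheses
    pass from \<open>x\<close> and \<open>t\<close> to \<open>x\<^sup>* x\<close> and \<open>t\<^sup>2\<close>, whose bound controls the square of the norm.\<close>
  have power_le: "norm (to_bidual y \<odot> k s) ^ (2 ^ n) \<le> 2"
    if "to_bidual y \<odot> p = p \<odot> to_bidual y" "norm (to_bidual y \<odot> k 0) \<le> 1"
      "norm (complex_of_real s *\<^sub>C (to_bidual y \<odot> p)) \<le> 1" for n y s
    using that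
  proof (induction n arbitrary: y s)
    case 0
    have "to_bidual y \<odot> k s = to_bidual y \<odot> k 0 + complex_of_real s *\<^sub>C (to_bidual y \<odot> p)"
      unfolding k0 by (simp add: k_def arens_add arens_scaleC)
    then show ?case using norm_triangle_ineq[of "to_bidual y \<odot> k 0" "complex_of_real s *\<^sub>C (to_bidual y \<odot> p)"] 0
      by simp
  next
    case (Suc n)
    have "norm (to_bidual (adj y \<cdot> y) \<odot> k 0) \<le> 1"
      using star_le[OF Suc.prems(2)] square[OF Suc.prems(1), of 0] by simp
    moreover have "norm (complex_of_real (s\<^sup>2) *\<^sub>C (to_bidual (adj y \<cdot> y) \<odot> p)) \<le> 1"
      using star_le[OF Suc.prems(3)] square_p[OF Suc.prems(1), of "complex_of_real s"]
      by (simp add: power2_eq_square)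
    ultimately have IH: "norm (to_bidual (adj y \<cdot> y) \<odot> k (s\<^sup>2)) ^ (2 ^ n) \<le> 2"
      by (rule Suc.IH[OF comm_sq[OF Suc.prems(1)]])
    have "norm (to_bidual y \<odot> k s) ^ (2 ^ Suc n) = ((norm (to_bidual y \<odot> k s))\<^sup>2) ^ (2 ^ n)"
      by (simp add: power_mult)
    also have "\<dots> \<le> norm (to_bidual (adj y \<cdot> y) \<odot> k (s\<^sup>2)) ^ (2 ^ n)"
      using bidual_cstar_inequality[of "to_bidual y \<odot> k s"] square[OF Suc.prems(1), of s]
      by (intro power_mono) simp_all
    finally show ?case using IH by simp
  qed
  have "norm (to_bidual x \<odot> k t) \<le> 1"
  proof (rule ccontr)
    assume "\<not> ?thesis"
    then have gt: "1 < norm (to_bidual x \<odot> k t)" by simp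
    then obtain n where "2 < norm (to_bidual x \<odot> k t) ^ n" using real_arch_pow by blast
    also have "\<dots> \<le> norm (to_bidual x \<odot> k t) ^ (2 ^ n)"
      using gt by (intro power_increasing) (auto intro: less_imp_le less_exp)
    also have "\<dots> \<le> 2" using comm out ins by (intro power_le) (simp_all add: k0)
    finally show False by simp
  qed
  then show ?thesis by (simp add: k_def arens_add arens_scaleC)
qed

section \<open>Limits of operators\<close>

instance complex_hilbert_space \<subseteq> banach ..

text \<open>
  The completeness of the space of operators, by transfer from real-linear bounded operators, in the
  form that sequences built by successive correction need.
\<close>
lemma cblinfun_geometric_Cauchy_limit:
  fixes X :: "nat \<Rightarrow> 'a::complex_normed_vector \<Rightarrow>\<^sub>c\<^sub>L 'b::complex_hilbert_space"
  assumes step: "\<And>n. norm (X (Suc n) - X n) \<le> C / 2 ^ n"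
  shows "\<exists>L. X \<longlonglongrightarrow> L \<and> norm (L - X 0) \<le> 2 * C"
proof -
  define Y where "Y n = Blinfun (cblinfun_apply (X n))" for n
  have Y: "blinfun_apply (Y n) = cblinfun_apply (X n)" for n
    by (simp add: Y_def bounded_linear_Blinfun_apply bounded_linear_cblinfun)
  have norm_Y: "norm (Y (Suc n) - Y n) \<le> C / 2 ^ n" for n
    using step[of n] by (simp add: norm_blinfun.rep_eq norm_cblinfun.rep_eq minus_blinfun.rep_eq
        minus_cblinfun.rep_eq Y)
  have geo: "(\<lambda>n. C / 2 ^ n) sums (2 * C)"
    using sums_mult[OF geometric_sums[of "1 / 2 :: real"], of C]
    by (simp add: power_divide mult.commute[of C])
  have sm: "summable (\<lambda>n. norm (Y (Suc n) - Y n))"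
    by (rule summable_comparison_test'[OF sums_summable[OF geo], of 0]) (simp add: norm_Y)
  then have "(\<lambda>n. \<Sum>k<n. Y (Suc k) - Y k) \<longlonglongrightarrow> (\<Sum>n. Y (Suc n) - Y n)"
    by (rule summable_LIMSEQ[OF summable_norm_cancel])
  then have "(\<lambda>n. (Y n - Y 0) + Y 0) \<longlonglongrightarrow> (\<Sum>n. Y (Suc n) - Y n) + Y 0"
    by (intro tendsto_add tendsto_const) (simp add: sum_lessThan_telescope)
  then have lim: "Y \<longlonglongrightarrow> (\<Sum>n. Y (Suc n) - Y n) + Y 0" by simp
  define B where "B = (\<Sum>n. Y (Suc n) - Y n) + Y 0"
  have lim_B: "Y \<longlonglongrightarrow> B" using lim by (simp add: B_def)
  have "norm (B - Y 0) \<le> (\<Sum>n. norm (Y (Suc n) - Y n))"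
    unfolding B_def by (simp add: summable_norm[OF sm])
  also have "\<dots> \<le> (\<Sum>n. C / 2 ^ n)" by (rule suminf_le[OF norm_Y sm sums_summable[OF geo]])
  also have "\<dots> = 2 * C" using geo by (rule sums_unique[symmetric])
  finally have norm_B: "norm (B - Y 0) \<le> 2 * C" .
  have "B (c *\<^sub>C x) = c *\<^sub>C B x" for c x
  proof (rule LIMSEQ_unique)
    have app: "(\<lambda>n. Y n y) \<longlonglongrightarrow> B y" for y
      by (rule bounded_linear.tendsto[OF blinfun.bounded_linear_left lim_B])
    show "(\<lambda>n. Y n (c *\<^sub>C x)) \<longlonglongrightarrow> B (c *\<^sub>C x)" by (rule app)
    show "(\<lambda>n. Y n (c *\<^sub>C x)) \<longlonglongrightarrow> c *\<^sub>C B x"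
      using bounded_linear.tendsto[OF bounded_linear_scaleC[of c] app[of x]]
      by (simp add: Y cblinfun_scaleC)
  qed
  then have B: "cblinfun_apply (CBlinfun B) = blinfun_apply B"
    by (simp add: CBlinfun_inverse blinfun.bounded_linear_right)
  have dist_eq: "norm (X n - CBlinfun B) = norm (Y n - B)" for n
    by (simp add: norm_blinfun.rep_eq norm_cblinfun.rep_eq minus_blinfun.rep_eq minus_cblinfun.rep_eq Y B)
  have "(\<lambda>n. norm (Y n - B)) \<longlonglongrightarrow> 0"
    using lim_B by (intro tendsto_norm_zero) (simp add: LIM_zero_iff)
  then have "X \<longlonglongrightarrow> CBlinfun B"
    unfolding dist_eq[symmetric] by (rule LIM_zero_cancel[OF tendsto_norm_zero_cancel])
  moreover have "norm (CBlinfun B - X 0) \<le> 2 * C"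
    using norm_B dist_eq[of 0] by (simp add: norm_minus_commute)
  ultimately show ?thesis by blast
qed

lift_definition right_arens :: "'h::complex_hilbert_space op_bidual \<Rightarrow> 'h op \<Rightarrow>\<^sub>c\<^sub>L 'h op_bidual"
  is "\<lambda>m T. to_bidual T \<odot> m"
proof -
  fix m :: "'h op_bidual"
  show "bounded_linear (\<lambda>T. to_bidual T \<odot> m) \<and> (\<forall>c T. to_bidual (c *\<^sub>C T) \<odot> m = c *\<^sub>C (to_bidual T \<odot> m))"
    by (rule cblinfun_raw[where K="norm m"])
      (auto simp: to_bidual_add to_bidual_scaleC arens_add arens_scaleC mult.commute[of "norm m"]
        intro: order_trans[OF norm_arens mult_right_mono[OF norm_to_bidual_le norm_ge_zero]])
qed

lift_definition left_arens :: "'h::complex_hilbert_space op_bidual \<Rightarrow> 'h op \<Rightarrow>\<^sub>c\<^sub>L 'h op_bidual"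
  is "\<lambda>m T. m \<odot> to_bidual T"
proof -
  fix m :: "'h op_bidual"
  show "bounded_linear (\<lambda>T. m \<odot> to_bidual T) \<and> (\<forall>c T. m \<odot> to_bidual (c *\<^sub>C T) = c *\<^sub>C (m \<odot> to_bidual T))"
    by (rule cblinfun_raw[where K="norm m"])
      (auto simp: to_bidual_add to_bidual_scaleC arens_add arens_scaleC
        intro: order_trans[OF norm_arens mult_left_mono[OF norm_to_bidual_le norm_ge_zero]])
qed

lift_definition left_mult :: "'h::complex_hilbert_space op \<Rightarrow> 'h op \<Rightarrow>\<^sub>c\<^sub>L 'h op"
  is "\<lambda>S T. S \<cdot> T"
proof -
  fix S :: "'h op"
  show "bounded_linear (\<lambda>T. S \<cdot> T) \<and> (\<forall>c T. S \<cdot> (c *\<^sub>C T) = c *\<^sub>C (S \<cdot> T))"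
    using cblinfun_raw[of "\<lambda>T. S \<cdot> T" "norm S"] by (simp add: ccomp_add_right ccomp_scaleC_right norm_ccomp)
qed

lemma tendsto_to_bidual_arens:
  fixes X :: "nat \<Rightarrow> 'h::complex_hilbert_space op"
  assumes "X \<longlonglongrightarrow> L"
  shows "(\<lambda>n. to_bidual (X n) \<odot> m) \<longlonglongrightarrow> to_bidual L \<odot> m"
    and "(\<lambda>n. m \<odot> to_bidual (X n)) \<longlonglongrightarrow> m \<odot> to_bidual L"
  using bounded_linear.tendsto[OF bounded_linear_cblinfun[of "right_arens m"] assms]
    bounded_linear.tendsto[OF bounded_linear_cblinfun[of "left_arens m"] assms]
  by (simp_all add: right_arens.rep_eq left_arens.rep_eq)

section \<open>An open projection belongs to the bidual of its hereditary subalgebra\<close>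

definition supported_right_ideal :: "'h::complex_hilbert_space op set \<Rightarrow> 'h op_bidual \<Rightarrow> 'h op set"
  where "supported_right_ideal A p = {T \<in> A. p \<odot> to_bidual T = to_bidual T}"

definition hereditary_subalgebra :: "'h::complex_hilbert_space op set \<Rightarrow> 'h op_bidual \<Rightarrow> 'h op set"
  where "hereditary_subalgebra A p =
    {T \<in> A. p \<odot> to_bidual T = to_bidual T \<and> to_bidual T \<odot> p = to_bidual T}"

lemma complex_subspace_supported_right_ideal:
  assumes "operator_algebra A"
  shows "complex_subspace (supported_right_ideal A p)"
  using assms
  by (simp add: complex_subspace_def supported_right_ideal_def operator_algebra_def to_bidual_add
      to_bidual_scaleC arens_add arens_scaleC)

lemma complex_subspace_hereditary_subalgebra:
  assumes "operator_algebra A"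
  shows "complex_subspace (hereditary_subalgebra A p)"
  using assms
  by (simp add: complex_subspace_def hereditary_subalgebra_def operator_algebra_def to_bidual_add
      to_bidual_scaleC arens_add arens_scaleC)

lemma hereditary_subalgebra_limit:
  assumes A: "operator_algebra A" and X: "\<And>n. X n \<in> hereditary_subalgebra A p" and lim: "X \<longlonglongrightarrow> L"
  shows "L \<in> hereditary_subalgebra A p"
proof -
  have "closed A" using A by (simp add: operator_algebra_def)
  then have "L \<in> A" using X by (intro closed_sequentially[OF _ _ lim]) (simp_all add: hereditary_subalgebra_def)
  have id_lim: "(\<lambda>n. to_bidual (X n)) \<longlonglongrightarrow> to_bidual L"
    using tendsto_to_bidual_arens(1)[OF lim, of "to_bidual cid"] by simp
  have "p \<odot> to_bidual L = to_bidual L"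
    using tendsto_to_bidual_arens(2)[OF lim, of p] X
    by (intro LIMSEQ_unique[OF _ id_lim]) (simp add: hereditary_subalgebra_def)
  moreover have "to_bidual L \<odot> p = to_bidual L"
    using tendsto_to_bidual_arens(1)[OF lim, of p] X
    by (intro LIMSEQ_unique[OF _ id_lim]) (simp add: hereditary_subalgebra_def)
  ultimately show ?thesis using \<open>L \<in> A\<close> by (simp add: hereditary_subalgebra_def)
qed

lemma open_projection_in_bidual_right_ideal:
  assumes "open_projection A p"
  shows "p \<in> bidual (supported_right_ideal A p)"
proof -
  obtain F :: "'a op filter" where F: "F \<noteq> bot"
    and ev: "\<forall>\<^sub>F x in F. x \<in> A \<and> to_bidual x = p \<odot> to_bidual x" and lim: "weak_star_tendsto to_bidual p F"
    using assms by (auto simp: open_projection_def)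
  have "p \<phi> = 0" if \<phi>: "\<forall>T\<in>supported_right_ideal A p. cblinfun_apply \<phi> T = 0" for \<phi>
  proof (rule tendsto_unique[OF F])
    show "((\<lambda>x. to_bidual x \<phi>) \<longlongrightarrow> p \<phi>) F" using lim by (simp add: weak_star_tendsto_def)
    have "\<forall>\<^sub>F x in F. to_bidual x \<phi> = 0"
      using ev by (rule eventually_mono) (use \<phi> in \<open>simp add: supported_right_ideal_def to_bidual.rep_eq\<close>)
    then show "((\<lambda>x. to_bidual x \<phi>) \<longlongrightarrow> 0) F" by (rule tendsto_eventually)
  qed
  then show ?thesis by (simp add: bidual_def)
qed

text \<open>
  Take adjoints of the net in the definition of openness: they need not lie in \<open>A\<close>, but they converge
  to \<open>p\<close> because \<open>p\<close> is self-adjoint.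
\<close>
lemma open_projection_in_bidual_left_ideal:
  assumes p: "open_projection A p"
  shows "p \<in> bidual {T. to_bidual T \<odot> p = to_bidual T}"
proof -
  have p_star: "bidual_star p = p" using p by (simp add: open_projection_def projection_def)
  have "p \<phi> = 0" if \<phi>: "\<forall>T\<in>{T. to_bidual T \<odot> p = to_bidual T}. cblinfun_apply \<phi> T = 0" for \<phi>
  proof -
    have "\<forall>T\<in>supported_right_ideal A p. dual_star \<phi> T = 0"
    proof
      fix T assume "T \<in> supported_right_ideal A p"
      then have "p \<odot> to_bidual T = to_bidual T" by (simp add: supported_right_ideal_def)
      then have "to_bidual (adj T) \<odot> p = to_bidual (adj T)"
        using bidual_star_arens_to_bidual(2)[of p T] by (simp add: p_star bidual_star_to_bidual)
      then show "dual_star \<phi> T = 0" using \<phi> by (simp add: dual_star.rep_eq)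
    qed
    then have "p (dual_star \<phi>) = 0"
      using open_projection_in_bidual_right_ideal[OF p] by (simp add: bidual_def)
    then have "bidual_star p \<phi> = 0" by (simp add: bidual_star.rep_eq)
    then show ?thesis by (simp add: p_star)
  qed
  then show ?thesis by (simp add: bidual_def)
qed

text \<open>
  A functional of the form \<open>T \<mapsto> f (T (1 - p))\<close>, for any \<open>f\<close> on the bidual, vanishes at all \<open>T\<close> with
  \<open>T p = T\<close>, and therefore at \<open>p\<close>. So the seminorm \<open>|T (1 - p)|\<close> can be made small together with
  any one other condition. The functional \<open>f\<close> need not be weak* continuous, so this does not
  follow merely from \<open>p (1 - p) = 0\<close>.
\<close>
lemma approximate_two_sided_support:
  fixes L :: "'h::complex_hilbert_space op \<Rightarrow>\<^sub>c\<^sub>L 'b::complex_normed_vector"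
  assumes A: "operator_algebra A" and p: "open_projection A p"
    and L: "\<And>\<phi> :: 'b dual. cmod (p (\<phi> \<cdot> L) + \<phi> x) \<le> s * norm \<phi>" "0 \<le> s" "s < r" and e: "0 < e"
  shows "\<exists>T\<in>supported_right_ideal A p. norm (to_bidual T \<odot> (to_bidual cid - p)) < e \<and> norm (L T + x) < r"
proof -
  define q where "q = to_bidual cid - p"
  have "\<exists>T\<in>supported_right_ideal A p. norm (right_arens q T + 0) < e \<and> norm (L T + x) < r"
  proof (rule simultaneous_approximation[OF complex_subspace_supported_right_ideal[OF A] _ _ order_refl e L])
    show "p \<phi> = 0" if "\<forall>T\<in>supported_right_ideal A p. cblinfun_apply \<phi> T = 0" for \<phi>
      using open_projection_in_bidual_right_ideal[OF p] that by (simp add: bidual_def)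
    show "cmod (p (\<phi> \<cdot> right_arens q) + \<phi> 0) \<le> 0 * norm \<phi>" for \<phi>
    proof -
      have "\<phi> 0 = 0" by (rule cblinfun_zero)
      moreover have "p (\<phi> \<cdot> right_arens q) = 0"
      proof -
        have "(\<phi> \<cdot> right_arens q) T = 0" if "to_bidual T \<odot> p = to_bidual T" for T
          using that \<open>\<phi> 0 = 0\<close> by (simp add: ccomp.rep_eq right_arens.rep_eq q_def arens_diff)
        then show ?thesis using open_projection_in_bidual_left_ideal[OF p] by (simp add: bidual_def)
      qed
      ultimately show ?thesis by simp
    qed
  qed
  then show ?thesis by (simp add: right_arens.rep_eq q_def)
qed

text \<open>
  The element \<open>d\<close> is an infinite product \<open>y V\<^sub>0 V\<^sub>1 V\<^sub>2 \<dots>\<close>. If \<open>|T (1 - p)|\<close> is small, then \<open>T p\<close> is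
  close to \<open>T\<close>, so a factor \<open>V\<close> close to \<open>p\<close> changes \<open>T\<close> little; and \<open>|T V (1 - p)| \<le> |T| |V (1 - p)|\<close>
  can be made as small as desired by the choice of \<open>V\<close>.
\<close>
lemma right_ideal_near_hereditary_subalgebra:
  assumes A: "operator_algebra A" and p: "open_projection A p"
    and y: "y \<in> supported_right_ideal A p" and y_le: "norm (to_bidual y \<odot> (to_bidual cid - p)) < \<delta>"
  shows "\<exists>d\<in>hereditary_subalgebra A p. norm (d - y) \<le> 2 * \<delta>"
proof -
  define q where "q = to_bidual cid - p"
  define P where "P n T \<longleftrightarrow> T \<in> supported_right_ideal A p \<and> norm (to_bidual T \<odot> q) < \<delta> / 2 ^ n \<and> (n = 0 \<longrightarrow> T = y)"
    for n :: nat and T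
  have \<delta>: "0 < \<delta>" by (rule le_less_trans[OF norm_ge_zero y_le])
  have "\<exists>X. \<forall>n. P n (X n) \<and> norm (X (Suc n) - X n) \<le> \<delta> / 2 ^ n"
  proof (rule dependent_nat_choice)
    show "\<exists>T. P 0 T" using y y_le by (simp add: P_def q_def)
    fix T n assume "P n T"
    then have T: "T \<in> supported_right_ideal A p" "norm (to_bidual T \<odot> q) < \<delta> / 2 ^ n"
      by (simp_all add: P_def)
    define e where "e = \<delta> / 2 ^ Suc n / (norm T + 1)"
    have e: "0 < e" using \<delta> by (simp add: e_def add_nonneg_pos)
    have "cmod (p (\<phi> \<cdot> left_mult T) + \<phi> (- T)) \<le> norm (to_bidual T \<odot> q) * norm \<phi>" for \<phi> :: "'a op dual"
    proof -
      have "bidual_act p \<phi> T = p (\<phi> \<cdot> left_mult T)"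
        unfolding bidual_act.rep_eq
        by (intro arg_cong[where f="cblinfun_apply p"] cblinfun_eqI)
          (simp add: dual_act.rep_eq ccomp.rep_eq left_mult.rep_eq)
      then have "(to_bidual T \<odot> p) \<phi> = p (\<phi> \<cdot> left_mult T)"
        by (simp add: arens.rep_eq to_bidual.rep_eq)
      then have "p (\<phi> \<cdot> left_mult T) + \<phi> (- T) = - (to_bidual T \<odot> q) \<phi>"
        using cblinfun_diff[of \<phi> 0 T]
        by (simp add: cblinfun_zero q_def arens_diff minus_cblinfun.rep_eq to_bidual.rep_eq uminus_cblinfun.rep_eq)
      then show ?thesis using norm_cblinfun[of "to_bidual T \<odot> q" \<phi>] by (simp add: uminus_cblinfun.rep_eq)
    qed
    from approximate_two_sided_support[OF A p this norm_ge_zero T(2) e]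
    obtain V where V: "V \<in> supported_right_ideal A p" "norm (to_bidual V \<odot> q) < e"
      "norm (left_mult T V + - T) < \<delta> / 2 ^ n"
      by (auto simp: q_def)
    have "norm (to_bidual (T \<cdot> V) \<odot> q) \<le> norm (to_bidual T) * norm (to_bidual V \<odot> q)"
      by (simp add: arens_to_bidual[symmetric] arens_assoc norm_arens)
    also have "\<dots> \<le> norm T * e" using V by (intro mult_mono norm_to_bidual_le) auto
    also have "\<dots> < (norm T + 1) * e" using e by simp
    also have "\<dots> = \<delta> / 2 ^ Suc n" using add_nonneg_pos[OF norm_ge_zero zero_less_one, of T] by (simp add: e_def)
    finally have "norm (to_bidual (T \<cdot> V) \<odot> q) < \<delta> / 2 ^ Suc n" .
    moreover have "T \<cdot> V \<in> supported_right_ideal A p"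
      using T(1) V(1) A
      by (simp add: supported_right_ideal_def operator_algebra_def arens_to_bidual[symmetric]
          arens_assoc[symmetric])
    ultimately have "P (Suc n) (T \<cdot> V)" by (simp add: P_def)
    moreover have "norm (T \<cdot> V - T) \<le> \<delta> / 2 ^ n" using V(3) by (simp add: left_mult.rep_eq)
    ultimately show "\<exists>V. P (Suc n) V \<and> norm (V - T) \<le> \<delta> / 2 ^ n" by blast
  qed
  then obtain X where X: "\<And>n. P n (X n)" and step: "\<And>n. norm (X (Suc n) - X n) \<le> \<delta> / 2 ^ n" by blast
  obtain d where lim: "X \<longlonglongrightarrow> d" and near: "norm (d - X 0) \<le> 2 * \<delta>"
    using cblinfun_geometric_Cauchy_limit[OF step] by blast
  have id_lim: "(\<lambda>n. to_bidual (X n)) \<longlonglongrightarrow> to_bidual d"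
    using tendsto_to_bidual_arens(1)[OF lim, of "to_bidual cid"] by simp
  have X_mem: "X n \<in> A" "p \<odot> to_bidual (X n) = to_bidual (X n)" for n
    using X[of n] by (simp_all add: P_def supported_right_ideal_def)
  have "closed A" using A by (simp add: operator_algebra_def)
  then have "d \<in> A" using X_mem(1) by (intro closed_sequentially[OF _ _ lim]) simp_all
  moreover have "p \<odot> to_bidual d = to_bidual d"
    using tendsto_to_bidual_arens(2)[OF lim, of p]
    by (intro LIMSEQ_unique[OF _ id_lim]) (simp add: X_mem)
  moreover have "to_bidual d \<odot> q = 0"
  proof (rule LIMSEQ_unique[OF tendsto_to_bidual_arens(1)[OF lim]])
    have "(\<lambda>n. \<delta> * (1 / 2) ^ n) \<longlonglongrightarrow> \<delta> * 0"
      by (intro tendsto_mult tendsto_const LIMSEQ_realpow_zero) auto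
    then have "(\<lambda>n. \<delta> / 2 ^ n) \<longlonglongrightarrow> 0" by (simp add: power_divide)
    moreover have "norm (to_bidual (X n) \<odot> q) \<le> \<delta> / 2 ^ n" for n
      using X[of n] by (simp add: P_def)
    ultimately show "(\<lambda>n. to_bidual (X n) \<odot> q) \<longlonglongrightarrow> 0"
      by (rule Lim_null_comparison[OF always_eventually[OF allI], rotated])
  qed
  then have "to_bidual d \<odot> p = to_bidual d" by (simp add: q_def arens_diff)
  ultimately have "d \<in> hereditary_subalgebra A p" by (simp add: hereditary_subalgebra_def)
  moreover have "X 0 = y" using X[of 0] by (simp add: P_def)
  ultimately show ?thesis using near by (intro bexI[of _ d]) simp
qed

text \<open>
  A functional that vanishes on the hereditary subalgebra is small at elements \<open>T\<close> of the right ideal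
  with small \<open>|T (1 - p)|\<close>, since these are close to that subalgebra. Such \<open>T\<close> can be chosen so
  that the functional nearly takes its value at \<open>p\<close>.
\<close>
lemma open_projection_in_bidual_hereditary_subalgebra:
  assumes A: "operator_algebra A" and p: "open_projection A p"
  shows "p \<in> bidual (hereditary_subalgebra A p)"
proof -
  have "p \<phi> = 0" if \<phi>: "\<forall>T\<in>hereditary_subalgebra A p. cblinfun_apply \<phi> T = 0" for \<phi> :: "'a op dual"
  proof (rule ccontr)
    assume ne: "p \<phi> \<noteq> 0"
    define e where "e = cmod (p \<phi>) / (1 + 2 * norm \<phi>)"
    have den: "0 < 1 + 2 * norm \<phi>" by (simp add: add_pos_nonneg)
    have e: "0 < e" using ne den by (simp add: e_def)
    have "cmod (p (f \<cdot> \<phi>) + f (- p \<phi>)) \<le> 0 * norm f" for f :: "complex dual"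
    proof -
      have lin: "f z = z * f 1" for z
        using cblinfun_scaleC[of f z 1] by (simp add: scaleC_complex_def)
      have "f \<cdot> \<phi> = f 1 *\<^sub>C \<phi>"
        by (rule cblinfun_eqI) (simp add: ccomp.rep_eq scaleC_cblinfun.rep_eq scaleC_complex_def
            lin[of "\<phi> _"] mult.commute)
      then show ?thesis using lin[of "- p \<phi>"] by (simp add: cblinfun_scaleC scaleC_complex_def)
    qed
    from approximate_two_sided_support[OF A p this order_refl e e] obtain T
      where T: "T \<in> supported_right_ideal A p" "norm (to_bidual T \<odot> (to_bidual cid - p)) < e"
        "cmod (\<phi> T - p \<phi>) < e"
      by auto
    then obtain d where d: "d \<in> hereditary_subalgebra A p" "norm (d - T) \<le> 2 * e"
      using right_ideal_near_hereditary_subalgebra[OF A p] by blast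
    have "cmod (\<phi> T) = cmod (\<phi> (d - T))" using \<phi> d by (simp add: cblinfun_diff)
    also have "\<dots> \<le> norm \<phi> * norm (d - T)" by (rule norm_cblinfun)
    also have "\<dots> \<le> norm \<phi> * (2 * e)" by (intro mult_left_mono d norm_ge_zero)
    finally have "cmod (p \<phi>) < e * (1 + 2 * norm \<phi>)"
      using T(3) norm_triangle_ineq2[of "p \<phi>" "\<phi> T"] by (simp add: norm_minus_commute algebra_simps)
    then show False using den by (simp add: e_def)
  qed
  then show ?thesis by (simp add: bidual_def)
qed

section \<open>Lifting without increase of norm\<close>

text \<open>
  Half of the excess of the norm over \<open>1\<close> is removed by a correction that is no larger than a fixed
  multiple of the excess; this is what makes the iteration converge.
\<close>
lemma shrink_modulo_hereditary_subalgebra: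
  assumes A: "operator_algebra A" and p: "open_projection A p" and x: "x \<in> A"
    and comm: "to_bidual x \<odot> p = p \<odot> to_bidual x"
    and out: "norm (to_bidual x \<odot> (to_bidual cid - p)) \<le> 1"
    and e: "0 < e" and x_le: "norm x \<le> 1 + e"
  shows "\<exists>j\<in>hereditary_subalgebra A p. norm j < 2 * e \<and> norm (x + j) < 1 + e / 2"
proof -
  define D where "D = hereditary_subalgebra A p"
  have proj: "projection p" using p by (simp add: open_projection_def)
  define t where "t = 1 / (1 + e)"
  have t: "0 < t" "t \<le> 1" "t * (1 + e) = 1" using e by (simp_all add: t_def)
  define m where "m = complex_of_real (t - 1) *\<^sub>C (to_bidual x \<odot> p)"
  have norm_xp: "norm (to_bidual x \<odot> p) \<le> 1 + e"
  proof -
    have "norm (to_bidual x \<odot> p) \<le> norm (to_bidual x) * norm p" by (rule norm_arens)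
    also have "\<dots> \<le> (1 + e) * 1"
      using e by (intro mult_mono norm_projection_le[OF proj] order_trans[OF norm_to_bidual_le x_le]) auto
    finally show ?thesis by simp
  qed
  have "norm (complex_of_real t *\<^sub>C (to_bidual x \<odot> p)) \<le> 1"
    using mult_left_mono[OF norm_xp, of t] t by (simp add: norm_scaleC)
  then have "norm (to_bidual x \<odot> (to_bidual cid - p) + complex_of_real t *\<^sub>C (to_bidual x \<odot> p)) \<le> 1"
    by (rule norm_projection_combination_le[OF proj comm out])
  moreover have "to_bidual x \<odot> (to_bidual cid - p) + complex_of_real t *\<^sub>C (to_bidual x \<odot> p) = m + to_bidual x"
    using scaleC_add_left[of "complex_of_real (t - 1)" 1 "to_bidual x \<odot> p"]
    by (simp add: m_def arens_diff)
  ultimately have norm_xm: "norm (m + to_bidual x) \<le> 1" by simp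
  have norm_m: "norm m \<le> e"
  proof -
    have "norm m = (1 - t) * norm (to_bidual x \<odot> p)" using t by (simp add: m_def norm_scaleC abs_if del: of_real_diff)
    also have "\<dots> \<le> (1 - t) * (1 + e)" using t by (intro mult_left_mono norm_xp) auto
    also have "\<dots> = e" using t by (simp add: algebra_simps)
    finally show ?thesis .
  qed
  have "m \<in> bidual D"
  proof -
    have "(to_bidual x \<odot> p) \<phi> = 0" if \<phi>: "\<forall>T\<in>D. cblinfun_apply \<phi> T = 0" for \<phi>
    proof -
      have "x \<cdot> T \<in> D" if "T \<in> D" for T
      proof -
        have T: "T \<in> A" "p \<odot> to_bidual T = to_bidual T" "to_bidual T \<odot> p = to_bidual T"
          using that by (auto simp: D_def hereditary_subalgebra_def)
        have "p \<odot> (to_bidual x \<odot> to_bidual T) = to_bidual x \<odot> to_bidual T"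
          by (metis T(2) arens_assoc comm)
        then show ?thesis using A x T
          by (simp add: D_def hereditary_subalgebra_def operator_algebra_def arens_to_bidual[symmetric]
              arens_assoc)
      qed
      then have "\<forall>T\<in>D. dual_act \<phi> x T = 0" using \<phi> by (simp add: dual_act.rep_eq)
      then have "p (dual_act \<phi> x) = 0"
        using open_projection_in_bidual_hereditary_subalgebra[OF A p] by (simp add: bidual_def D_def)
      then show ?thesis by (simp add: arens.rep_eq to_bidual.rep_eq bidual_act.rep_eq)
    qed
    then have "to_bidual x \<odot> p \<in> bidual D" by (simp add: bidual_def)
    then show ?thesis unfolding m_def by (rule bidual_scaleC)
  qed
  then have m0: "m \<phi> = 0" if "\<forall>T\<in>D. cblinfun_apply \<phi> T = 0" for \<phi> using that by (simp add: bidual_def)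
  have "\<exists>j\<in>D. norm (cid j + 0) < 2 * e \<and> norm (cid j + x) < 1 + e / 2"
  proof (rule simultaneous_approximation[OF _ m0])
    show "complex_subspace D" unfolding D_def by (rule complex_subspace_hereditary_subalgebra[OF A])
    fix \<phi> :: "'a op dual"
    have "\<phi> 0 = 0" by (rule cblinfun_zero)
    then show "cmod (m (\<phi> \<cdot> cid) + \<phi> 0) \<le> e * norm \<phi>"
      using norm_cblinfun[of m \<phi>] mult_right_mono[OF norm_m, of "norm \<phi>"] by simp
    show "cmod (m (\<phi> \<cdot> cid) + \<phi> x) \<le> 1 * norm \<phi>"
      using norm_cblinfun[of "m + to_bidual x" \<phi>] mult_right_mono[OF norm_xm, of "norm \<phi>"]
      by (simp add: plus_cblinfun.rep_eq to_bidual.rep_eq)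
  qed (use e in simp_all)
  then show ?thesis by (simp add: D_def cid.rep_eq add.commute)
qed

theorem corollary2p2:
  fixes A :: "('h::complex_hilbert_space) op set" and p :: "'h op_bidual" and b :: "'h op"
  assumes "operator_algebra A"
    and "open_projection A p"
    and "b \<in> A"
    and "to_bidual b \<odot> p = p \<odot> to_bidual b"
    and "norm (to_bidual b \<odot> (bidual_one A - p)) \<le> 1"
  shows "\<exists>g\<in>A. norm g \<le> 1 \<and>
    to_bidual g \<odot> (bidual_one A - p) = to_bidual b \<odot> (bidual_one A - p) \<and>
    (bidual_one A - p) \<odot> to_bidual g = to_bidual b \<odot> (bidual_one A - p)"
proof -
  note A = assms(1) and p = assms(2) and b = assms(3) and comm = assms(4)
  define D where "D = hereditary_subalgebra A p"
  have D_sub: "complex_subspace D" unfolding D_def by (rule complex_subspace_hereditary_subalgebra[OF A])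
  have D: "d \<in> A" "p \<odot> to_bidual d = to_bidual d" "to_bidual d \<odot> p = to_bidual d" if "d \<in> D" for d
    using that by (auto simp: D_def hereditary_subalgebra_def)
  have A_add: "S + T \<in> A" if "S \<in> A" "T \<in> A" for S T using A that by (simp add: operator_algebra_def)
  have A1: "T \<in> unitization A" if "T \<in> A" for T using subset_unitization that by blast
  \<comment> \<open>The unit of the unitization need not be the identity operator, but both act on \<open>A\<close> in the same
    way, so the hypothesis on \<open>b\<close> is one about \<open>b - b p\<close>.\<close>
  have one: "to_bidual T \<odot> (bidual_one A - p) = to_bidual T - to_bidual T \<odot> p"
    "(bidual_one A - p) \<odot> to_bidual T = to_bidual T - p \<odot> to_bidual T" if "T \<in> A" for T
    using is_identity_unitization_one[OF A] A1[OF that]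
    by (simp_all add: is_identity_def bidual_one_def arens_diff arens_to_bidual)
  have one_cid: "to_bidual T \<odot> (to_bidual cid - p) = to_bidual T - to_bidual T \<odot> p" for T
    by (simp add: arens_diff)
  have shift: "to_bidual (b + d) \<odot> p = p \<odot> to_bidual (b + d)"
    "to_bidual (b + d) - to_bidual (b + d) \<odot> p = to_bidual b - to_bidual b \<odot> p" if "d \<in> D" for d
    using comm D[OF that] by (simp_all add: to_bidual_add arens_add)
  define C where "C = norm b + 1"
  have C: "0 < C" by (simp add: C_def add_nonneg_pos)
  define P where "P n x \<longleftrightarrow> x - b \<in> D \<and> norm x \<le> 1 + C / 2 ^ n" for n :: nat and x
  have "\<exists>X. \<forall>n. P n (X n) \<and> norm (X (Suc n) - X n) \<le> (2 * C) / 2 ^ n"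
  proof (rule dependent_nat_choice)
    show "\<exists>x. P 0 x" using D_sub by (auto simp: P_def C_def complex_subspace_def intro!: exI[of _ b])
    fix x n assume "P n x"
    then have x: "x - b \<in> D" "norm x \<le> 1 + C / 2 ^ n" by (simp_all add: P_def)
    have xA: "x \<in> A" using A_add[OF b D(1)[OF x(1)]] by simp
    have "norm (to_bidual x \<odot> (to_bidual cid - p)) \<le> 1"
      using assms(5) shift(2)[OF x(1)] one(1)[OF b] by (simp add: one_cid)
    moreover have "to_bidual x \<odot> p = p \<odot> to_bidual x" using shift(1)[OF x(1)] by simp
    ultimately obtain j where j: "j \<in> D" "norm j < 2 * (C / 2 ^ n)" "norm (x + j) < 1 + C / 2 ^ n / 2"
      using shrink_modulo_hereditary_subalgebra[OF A p xA _ _ _ x(2)] C by (auto simp: D_def)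
    have "(x - b) + j \<in> D" using x(1) j(1) D_sub by (simp add: complex_subspace_def)
    then have "P (Suc n) (x + j)" using j by (simp add: P_def algebra_simps)
    moreover have "norm (x + j - x) \<le> (2 * C) / 2 ^ n" using j by simp
    ultimately show "\<exists>y. P (Suc n) y \<and> norm (y - x) \<le> (2 * C) / 2 ^ n" by blast
  qed
  then obtain X where X: "\<And>n. P n (X n)" and step: "\<And>n. norm (X (Suc n) - X n) \<le> (2 * C) / 2 ^ n"
    by blast
  obtain g where lim: "X \<longlonglongrightarrow> g"
    using cblinfun_geometric_Cauchy_limit[OF step] by blast
  have "g - b \<in> D"
    unfolding D_def
  proof (rule hereditary_subalgebra_limit[OF A])
    show "X n - b \<in> hereditary_subalgebra A p" for n using X[of n] by (simp add: P_def D_def)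
    show "(\<lambda>n. X n - b) \<longlonglongrightarrow> g - b" by (intro tendsto_diff lim tendsto_const)
  qed
  have "norm g \<le> 1"
  proof (rule LIMSEQ_le[OF tendsto_norm[OF lim]])
    have "(\<lambda>n. 1 + C * (1 / 2) ^ n) \<longlonglongrightarrow> 1 + C * 0"
      by (intro tendsto_add tendsto_mult tendsto_const LIMSEQ_realpow_zero) auto
    then show "(\<lambda>n. 1 + C / 2 ^ n) \<longlonglongrightarrow> 1" by (simp add: power_divide)
    show "\<exists>N. \<forall>n\<ge>N. norm (X n) \<le> 1 + C / 2 ^ n" using X by (simp add: P_def)
  qed
  moreover have "g \<in> A" using A_add[OF b D(1)[OF \<open>g - b \<in> D\<close>]] by simp
  moreover have "to_bidual g \<odot> (bidual_one A - p) = to_bidual b \<odot> (bidual_one A - p)"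
    using shift(2)[OF \<open>g - b \<in> D\<close>] by (simp add: one \<open>g \<in> A\<close> b)
  moreover have "(bidual_one A - p) \<odot> to_bidual g = to_bidual b \<odot> (bidual_one A - p)"
    using shift[OF \<open>g - b \<in> D\<close>] by (simp add: one \<open>g \<in> A\<close> b)
  ultimately show ?thesis by blast
qed

end
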